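(* The problem of deciding whether a given graph $G$ admits an involutive automorphism $f$ such that $e \cap f(e) = \emptyset$ for every edge $e$ of $G$ is GI-hard, even when restricted to bipartite graphs.
   Context: An automorphism $f$ of $G$ is involutive if $f \circ f$ is the identity; for an edge $e=\{u,v\}$, $f(e)=\{f(u),f(v)\}$. A problem is GI-hard if the Graph Isomorphism problem (deciding whether two given graphs are isomorphic) reduces to it in polynomial time. *)

theory Defs
  imports Complex_Main "HOL-Computational_Algebra.Polynomial"
begin

section \<open>Deterministic multi-tape Turing machines\<close>

datatype move = MLeft | MStay | MRight

fun move_offset :: "move \<Rightarrow> int" where
  "move_offset MLeft = -1"
| "move_offset MStay = 0"
| "move_offset MRight = 1"

text \<open>Tapes are infinite in both directions; a tape is given by its cells and its head position.\<close>

type_synonym tape = "(int \<Rightarrow> nat) \<times> int"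

text \<open>The states are \<open>0, \<dots>, num_states M\<close>, where \<open>0\<close> is initial and \<open>num_states M\<close> is the unique
  halting state. The tape alphabet is \<open>{..<num_symbols M}\<close>, where \<open>0\<close> is the blank. The transition
  function takes a state and the list of scanned symbols (one per tape) to the next state and, for
  each tape, the symbol written and the head movement.\<close>

record tm =
  num_tapes :: nat
  num_symbols :: nat
  num_states :: nat
  trans_fun :: "nat \<Rightarrow> nat list \<Rightarrow> nat \<times> (nat \<times> move) list"

text \<open>At least two tapes are required (tape 0 carries the input, tape 1 the output) and at least
  three symbols (the blank and the two bits).\<close>

definition wf_tm :: "tm \<Rightarrow> bool" where
  "wf_tm M \<longleftrightarrow> 2 \<le> num_tapes M \<and> 3 \<le> num_symbols M \<and>
     (\<forall>q < num_states M. \<forall>syms. length syms = num_tapes M \<and> set syms \<subseteq> {..<num_symbols M} \<longrightarrow>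
        (case trans_fun M q syms of (q', acts) \<Rightarrow>
           q' \<le> num_states M \<and> length acts = num_tapes M \<and> fst ` set acts \<subseteq> {..<num_symbols M}))"

type_synonym tm_config = "nat \<times> tape list"

fun scan :: "tape \<Rightarrow> nat" where
  "scan (c, h) = c h"

fun act :: "nat \<times> move \<Rightarrow> tape \<Rightarrow> tape" where
  "act (s, m) (c, h) = (c(h := s), h + move_offset m)"

definition tm_step :: "tm \<Rightarrow> tm_config \<Rightarrow> tm_config" where
  "tm_step M cfg = (case cfg of (q, tps) \<Rightarrow>
     if q = num_states M then cfg
     else case trans_fun M q (map scan tps) of (q', acts) \<Rightarrow> (q', map2 act acts tps))"

definition bit_symbol :: "bool \<Rightarrow> nat" where
  "bit_symbol b = (if b then 2 else 1)"

definition blank_tape :: tape where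
  "blank_tape = ((\<lambda>_. 0), 0)"

definition input_tape :: "bool list \<Rightarrow> tape" where
  "input_tape x =
     ((\<lambda>i. if 0 \<le> i \<and> i < int (length x) then bit_symbol (x ! nat i) else 0), 0)"

definition init_config :: "tm \<Rightarrow> bool list \<Rightarrow> tm_config" where
  "init_config M x = (0, input_tape x # replicate (num_tapes M - 1) blank_tape)"

text \<open>The output string is read off from cell 0 onwards up to the first blank.\<close>

definition tape_holds :: "tape \<Rightarrow> bool list \<Rightarrow> bool" where
  "tape_holds tp y \<longleftrightarrow>
     (\<forall>i < length y. fst tp (int i) = bit_symbol (y ! i)) \<and> fst tp (int (length y)) = 0"

definition computes_within :: "tm \<Rightarrow> bool list \<Rightarrow> bool list \<Rightarrow> nat \<Rightarrow> bool" where
  "computes_within M x y t \<longleftrightarrow>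
     (case (tm_step M ^^ t) (init_config M x) of (q, tps) \<Rightarrow>
        q = num_states M \<and> tape_holds (tps ! 1) y)"

section \<open>Decision problems and polynomial-time many-one reductions\<close>

text \<open>A decision problem has a set of admissible instances (so that a problem may be restricted to
  a class of inputs), an encoding of the instances as bit strings, and the predicate to be decided.\<close>

record 'i problem =
  instances :: "'i set"
  encoding :: "'i \<Rightarrow> bool list"
  yes_instance :: "'i \<Rightarrow> bool"

definition restrict_problem :: "'i problem \<Rightarrow> ('i \<Rightarrow> bool) \<Rightarrow> 'i problem" where
  "restrict_problem P C = P\<lparr>instances := {x \<in> instances P. C x}\<rparr>"

definition poly_time_computable ::
    "'i set \<Rightarrow> ('i \<Rightarrow> bool list) \<Rightarrow> ('j \<Rightarrow> bool list) \<Rightarrow> ('i \<Rightarrow> 'j) \<Rightarrow> bool" where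
  "poly_time_computable I enc enc' g \<longleftrightarrow>
     (\<exists>M (p :: nat poly). wf_tm M \<and>
        (\<forall>x \<in> I. computes_within M (enc x) (enc' (g x)) (poly p (length (enc x)))))"

definition poly_time_reduces :: "'i problem \<Rightarrow> 'j problem \<Rightarrow> bool" where
  "poly_time_reduces P Q \<longleftrightarrow>
     (\<exists>g. (\<forall>x \<in> instances P. g x \<in> instances Q \<and> (yes_instance Q (g x) \<longleftrightarrow> yes_instance P x)) \<and>
          poly_time_computable (instances P) (encoding P) (encoding Q) g)"

section \<open>Finite simple graphs\<close>

text \<open>A pair \<open>(n, E)\<close> stands for the graph with vertex set \<open>{0, \<dots>, n - 1}\<close> and edge set \<open>E\<close>.\<close>

type_synonym graph = "nat \<times> nat set set"

definition verts :: "graph \<Rightarrow> nat set" where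
  "verts G = {..<fst G}"

definition edges :: "graph \<Rightarrow> nat set set" where
  "edges G = snd G"

definition simple_graph :: "graph \<Rightarrow> bool" where
  "simple_graph G \<longleftrightarrow> edges G \<subseteq> {{u, v} | u v. u \<in> verts G \<and> v \<in> verts G \<and> u \<noteq> v}"

definition graph_isomorphism :: "(nat \<Rightarrow> nat) \<Rightarrow> graph \<Rightarrow> graph \<Rightarrow> bool" where
  "graph_isomorphism f G H \<longleftrightarrow> bij_betw f (verts G) (verts H) \<and>
     (\<forall>u \<in> verts G. \<forall>v \<in> verts G. {u, v} \<in> edges G \<longleftrightarrow> {f u, f v} \<in> edges H)"

definition isomorphic :: "graph \<Rightarrow> graph \<Rightarrow> bool" where
  "isomorphic G H \<longleftrightarrow> (\<exists>f. graph_isomorphism f G H)"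

definition automorphism :: "(nat \<Rightarrow> nat) \<Rightarrow> graph \<Rightarrow> bool" where
  "automorphism f G \<longleftrightarrow> graph_isomorphism f G G"

definition involutive_automorphism :: "(nat \<Rightarrow> nat) \<Rightarrow> graph \<Rightarrow> bool" where
  "involutive_automorphism f G \<longleftrightarrow> automorphism f G \<and> (\<forall>v \<in> verts G. f (f v) = v)"

definition bipartite :: "graph \<Rightarrow> bool" where
  "bipartite G \<longleftrightarrow> (\<exists>X Y. X \<union> Y = verts G \<and> X \<inter> Y = {} \<and>
     (\<forall>e \<in> edges G. \<exists>x \<in> X. \<exists>y \<in> Y. e = {x, y}))"

text \<open>The number of vertices in unary, terminated by a zero, followed by the adjacency matrix row by
  row. This is self-delimiting, so a pair of graphs can be encoded by concatenation.\<close>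

definition encode_graph :: "graph \<Rightarrow> bool list" where
  "encode_graph G = replicate (fst G) True @ [False] @
     concat (map (\<lambda>u. map (\<lambda>v. {u, v} \<in> edges G) [0..<fst G]) [0..<fst G])"

section \<open>The problems\<close>

definition GI_problem :: "(graph \<times> graph) problem" where
  "GI_problem =
     \<lparr>instances = {(G, H). simple_graph G \<and> simple_graph H},
      encoding = (\<lambda>(G, H). encode_graph G @ encode_graph H),
      yes_instance = (\<lambda>(G, H). isomorphic G H)\<rparr>"

definition GI_hard :: "'i problem \<Rightarrow> bool" where
  "GI_hard P \<longleftrightarrow> poly_time_reduces GI_problem P"

definition edge_disjoint_involution_problem :: "graph problem" where
  "edge_disjoint_involution_problem =
     \<lparr>instances = {G. simple_graph G},
      encoding = encode_graph,
      yes_instance = (\<lambda>G. \<exists>f. involutive_automorphism f G \<and> (\<forall>e \<in> edges G. e \<inter> f ` e = {}))\<rparr>"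

end

(*
  To each vertex i of G and of H attach a path i0 - i1 - i2 - i3, join i0 and j3 for every edge {i, j},
  and join all the i0 of one graph to a hub carrying three leaves. The result is bipartite. Its two
  hubs are the only vertices with two leaf neighbours, so an involutive automorphism moving every
  vertex swaps them, hence also the sets of vertices i0, which are the non-leaf neighbours of the
  hubs. Since i and j are adjacent iff i0 and j0 are joined by a walk of length four whose inner
  vertices avoid the hubs and their neighbours and whose first and third inner vertices differ, this
  gives an isomorphism of G and H. Conversely an isomorphism swaps the two halves.

  The adjacency matrix of the gadget is written by a six-tape machine obtained by compiling a small
  while-language: tapes 2 and 3 hold the list of vertices and hubs and serve as row and column
  counters, the head of tape 4 stands on its only mark iff row and column agree, and tape 5 holds
  the two input matrices.
*)

theory Submission
  imports Defs
begin


section \<open>A structured language for Turing machines\<close>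

text \<open>An edge disjoint from its image has no fixed endpoint, and the gadget has no isolated
  vertex; this is how the condition forces every vertex to move. In the other direction no edge
  joins the two halves, so exchanging them carries each edge to the other half. Bipartiteness
  dictates how an edge {i, j} is represented: joining i0 to j0 would copy the odd cycles of the
  input, whereas i0 and j3 always lie in different colour classes. A single leaf would not identify
  a hub: if i is isolated, then i3 is itself a leaf, hanging from i2. Two leaves suffice for that.
  The third makes a hub own four vertices like everything else, so that the adjacency matrix
  consists of 4 by 4 blocks, each determined by the kinds of two objects, their equality and one
  input bit. A reduction requires an explicit machine with a time bound, which has no random access
  to the input matrices. Writing the output in matrix order therefore means sweeping over the list
  of objects and keeping the input head in step with the sweep.\<close>

datatype com =
    Act nat "nat list \<Rightarrow> nat \<times> move"
  | Seq com com  (infixr \<open>;;\<close> 60)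
  | While "nat list \<Rightarrow> bool" com

fun nst :: "com \<Rightarrow> nat" where
  "nst (Act k g) = 1"
| "nst (c ;; d) = nst c + nst d"
| "nst (While p c) = Suc (nst c)"

text \<open>A program is entered in state 0 and left in state \<open>nst c\<close>, as the machine
  model prescribes for halting. In a sequence the exit of the first part is the entry of the second;
  a loop spends its state 0 on the test and sends the exit of its body back there.\<close>

fun delta :: "com \<Rightarrow> nat \<Rightarrow> nat list \<Rightarrow> nat \<times> (nat \<times> move) list" where
  "delta (Act k g) q sy = (1, (map (\<lambda>s. (s, MStay)) sy)[k := g sy])"
| "delta (c ;; d) q sy =
     (if q < nst c then delta c q sy else apfst ((+) (nst c)) (delta d (q - nst c) sy))"
| "delta (While p c) q sy =
     (if q = 0 then (if p sy then 1 else Suc (nst c), map (\<lambda>s. (s, MStay)) sy)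
      else apfst (\<lambda>r. if r = nst c then 0 else Suc r) (delta c (q - 1) sy))"

fun wf_com :: "nat \<Rightarrow> nat \<Rightarrow> com \<Rightarrow> bool" where
  "wf_com K N (Act k g) \<longleftrightarrow> k < K \<and>
     (\<forall>sy. length sy = K \<and> set sy \<subseteq> {..<N} \<longrightarrow> fst (g sy) < N)"
| "wf_com K N (c ;; d) \<longleftrightarrow> wf_com K N c \<and> wf_com K N d"
| "wf_com K N (While p c) \<longleftrightarrow> wf_com K N c"

definition compile :: "nat \<Rightarrow> nat \<Rightarrow> com \<Rightarrow> tm" where
  "compile K N c = \<lparr>num_tapes = K, num_symbols = N, num_states = nst c, trans_fun = delta c\<rparr>"

text \<open>The time is that of the compiled machine: each action and each loop test costs one step,
  and sequencing is free.\<close>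

inductive exec :: "com \<Rightarrow> tape list \<Rightarrow> nat \<Rightarrow> tape list \<Rightarrow> bool" where
  exec_Act: "k < length s \<Longrightarrow> exec (Act k g) s 1 (s[k := act (g (map scan s)) (s ! k)])"
| exec_Seq: "exec c s t s' \<Longrightarrow> exec d s' t' s'' \<Longrightarrow> exec (c ;; d) s (t + t') s''"
| exec_While_True: "p (map scan s) \<Longrightarrow> exec c s t s' \<Longrightarrow> exec (While p c) s' t' s'' \<Longrightarrow>
    exec (While p c) s (Suc (t + t')) s''"
| exec_While_False: "\<not> p (map scan s) \<Longrightarrow> exec (While p c) s 1 s"

lemma nst_pos: "0 < nst c"
  by (induction c) auto

lemma delta_wf:
  assumes "wf_com K N c" "q < nst c" "length sy = K" "set sy \<subseteq> {..<N}"
  shows "fst (delta c q sy) \<le> nst c \<and> length (snd (delta c q sy)) = K \<and>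
    fst ` set (snd (delta c q sy)) \<subseteq> {..<N}"
  using assms
proof (induction c arbitrary: q)
  case (Act k g)
  have "set ((map (\<lambda>s. (s, MStay)) sy)[k := g sy]) \<subseteq> insert (g sy) ((\<lambda>s. (s, MStay)) ` set sy)"
    using set_update_subset_insert[of "map (\<lambda>s. (s, MStay)) sy" k "g sy"] by simp
  then show ?case using Act by fastforce
next
  case (Seq c d)
  show ?case
  proof (cases "q < nst c")
    case True
    then show ?thesis using Seq.IH(1)[of q] Seq.prems by auto
  next
    case False
    then have "q - nst c < nst d" using Seq.prems by auto
    then show ?thesis using False Seq.IH(2)[of "q - nst c"] Seq.prems by auto
  qed
next
  case (While p c)
  show ?case
  proof (cases q)
    case 0
    then show ?thesis using While.prems by auto
  next
    case (Suc r)
    then show ?thesis using While.IH[of r] While.prems by auto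
  qed
qed

lemma wf_compile:
  assumes "wf_com K N c" "2 \<le> K" "3 \<le> N"
  shows "wf_tm (compile K N c)"
  unfolding wf_tm_def compile_def using delta_wf[OF assms(1)] assms(2,3)
  by (simp add: case_prod_unfold)

text \<open>Unlike iterates of \<^const>\<open>tm_step\<close>, these runs never idle in the halting state, so that they
  can be transported into a larger machine.\<close>

inductive run :: "com \<Rightarrow> nat \<Rightarrow> tm_config \<Rightarrow> tm_config \<Rightarrow> bool" where
  run_0: "run c 0 x x"
| run_Suc: "q < nst c \<Longrightarrow> delta c q (map scan s) = (q', a) \<Longrightarrow> run c t (q', map2 act a s) y \<Longrightarrow>
    run c (Suc t) (q, s) y"

lemma run_trans: "run c t x y \<Longrightarrow> run c t' y z \<Longrightarrow> run c (t + t') x z"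
  by (induction rule: run.induct) (auto intro: run.intros)

lemma run_Seq1: "run c t x y \<Longrightarrow> run (c ;; d) t x y"
  by (induction rule: run.induct) (auto intro!: run.intros)

lemma run_Seq2:
  "run d t x y \<Longrightarrow> run (c ;; d) t (nst c + fst x, snd x) (nst c + fst y, snd y)"
  by (induction rule: run.induct) (auto intro!: run.intros)

text \<open>The conditional translates states of the body into states of the loop: the exit becomes
  the test, every other state moves up by one.\<close>

lemma run_While:
  "run c t x y \<Longrightarrow> run (While p c) t (if fst x = nst c then 0 else Suc (fst x), snd x)
     (if fst y = nst c then 0 else Suc (fst y), snd y)"
  by (induction rule: run.induct) (auto intro!: run.intros)

lemma act_keep: "act (scan x, MStay) x = x"
  by (cases x) simp

lemma map2_act_keep: "map2 act (map (\<lambda>s. (s, MStay)) (map scan s)) s = s"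
  by (induction s) (auto simp: act_keep)

lemma map2_act_update:
  "k < length s \<Longrightarrow>
   map2 act ((map (\<lambda>s. (s, MStay)) (map scan s))[k := a]) s = s[k := act a (s ! k)]"
  by (intro nth_equalityI) (auto simp: nth_list_update act_keep)

lemma exec_run: "exec c s t s' \<Longrightarrow> run c t (0, s) (nst c, s')"
proof (induction rule: exec.induct)
  case (exec_Act k s g)
  show ?case unfolding One_nat_def
    by (rule run_Suc, simp, subst delta.simps, rule refl, unfold map2_act_update[OF exec_Act] nst.simps,
        rule run_0)
next
  case (exec_Seq c s t s' d t' s'')
  show ?case
    using run_trans[OF run_Seq1[OF exec_Seq.IH(1), of d] run_Seq2[OF exec_Seq.IH(2), of c, simplified]]
    by simp
next
  case (exec_While_True p s c t s' t' s'')
  have *: "run (While p c) t (Suc 0, s) (0, s')"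
    using run_While[OF exec_While_True.IH(1), of p] nst_pos[of c] by auto
  have "run (While p c) (Suc (t + t')) (0, s) (nst (While p c), s'')"
    by (rule run_Suc[OF _ _ run_trans[OF _ exec_While_True.IH(2)]], simp,
        subst delta.simps, simp only: if_True refl exec_While_True.hyps(1),
        unfold map2_act_keep, use * in simp)
  then show ?case .
next
  case (exec_While_False p s c)
  show ?case unfolding One_nat_def
    by (rule run_Suc, simp, subst delta.simps,
        simp only: if_True if_False refl exec_While_False, unfold map2_act_keep nst.simps, rule run_0)
qed

lemma run_tm_step: "run c t x y \<Longrightarrow> (tm_step (compile K N c) ^^ t) x = y"
  by (induction rule: run.induct)
    (auto simp: tm_step_def compile_def funpow_Suc_right simp del: funpow.simps(2))

lemma tm_step_halted: "(tm_step (compile K N c) ^^ t) (nst c, s) = (nst c, s)"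
  by (induction t) (auto simp: tm_step_def compile_def)

text \<open>With an upper bound instead of an exact time, all iterations of a loop can share one
  bound.\<close>

definition reach :: "com \<Rightarrow> tape list \<Rightarrow> nat \<Rightarrow> tape list \<Rightarrow> bool" where
  "reach c s T s' \<longleftrightarrow> (\<exists>t \<le> T. exec c s t s')"

text \<open>The halting state is a fixed point of \<open>tm_step\<close>, so the steps left over
  before \<open>T\<close> change nothing.\<close>

lemma reach_tm_step:
  assumes "reach c s T s'"
  shows "(tm_step (compile K N c) ^^ T) (0, s) = (nst c, s')"
proof -
  obtain t where t: "t \<le> T" "exec c s t s'" using assms by (auto simp: reach_def)
  have "(tm_step (compile K N c) ^^ (T - t + t)) (0, s) = (nst c, s')"
    unfolding funpow_add using run_tm_step[OF exec_run[OF t(2)], of K N] tm_step_halted by simp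
  then show ?thesis using t(1) by simp
qed

lemma reach_mono: "reach c s T s' \<Longrightarrow> T \<le> T' \<Longrightarrow> reach c s T' s'"
  unfolding reach_def by (meson le_trans)

lemma reach_Act:
  "k < length s \<Longrightarrow> s' = s[k := act (g (map scan s)) (s ! k)] \<Longrightarrow> reach (Act k g) s 1 s'"
  unfolding reach_def using exec_Act by blast

lemma reach_Seq: "reach c s T s' \<Longrightarrow> reach d s' T' s'' \<Longrightarrow> reach (c ;; d) s (T + T') s''"
  unfolding reach_def by (meson exec_Seq add_mono)

text \<open>Loops are verified by naming the configuration \<open>S i\<close> before each iteration;
  this sequence plays the part of an invariant and a variant at once.\<close>

lemma reach_While:
  assumes "\<And>i. i < N \<Longrightarrow> p (map scan (S i))" "\<not> p (map scan (S N))"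
    and "\<And>i. i < N \<Longrightarrow> reach c (S i) B (S (Suc i))"
  shows "reach (While p c) (S 0) (Suc (N * Suc B)) (S N)"
proof -
  \<comment> \<open>\<open>d\<close> counts the iterations still to come, because
    \<open>exec_While_True\<close> splits off the first one.\<close>
  have "reach (While p c) (S (N - d)) (Suc (d * Suc B)) (S N)" if "d \<le> N" for d
    using that
  proof (induction d)
    case 0
    then show ?case using exec_While_False[of p "S N", OF assms(2)] by (auto simp: reach_def)
  next
    case (Suc d)
    then have less: "N - Suc d < N" "Suc (N - Suc d) = N - d" by auto
    obtain t where t: "t \<le> B" "exec c (S (N - Suc d)) t (S (N - d))"
      using assms(3)[OF less(1)] less(2) by (auto simp: reach_def)
    obtain t' where t': "t' \<le> Suc (d * Suc B)" "exec (While p c) (S (N - d)) t' (S N)"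
      using Suc by (auto simp: reach_def)
    show ?case
      unfolding reach_def using exec_While_True[of p, OF assms(1)[OF less(1)] t(2) t'(2)] t(1) t'(1)
      by (intro exI[of _ "Suc (t + t')"]) auto
  qed
  from this[of N] show ?thesis by simp
qed


section \<open>Loop-free programs and their symbolic evaluation\<close>

fun straight :: "com \<Rightarrow> bool" where
  "straight (Act k g) = True"
| "straight (c ;; d) = (straight c \<and> straight d)"
| "straight (While p c) = False"

fun tapes_below :: "nat \<Rightarrow> com \<Rightarrow> bool" where
  "tapes_below K (Act k g) = (k < K)"
| "tapes_below K (c ;; d) = (tapes_below K c \<and> tapes_below K d)"
| "tapes_below K (While p c) = tapes_below K c"

fun eval_straight :: "com \<Rightarrow> tape list \<Rightarrow> tape list" where
  "eval_straight (Act k g) s = s[k := act (g (map scan s)) (s ! k)]"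
| "eval_straight (c ;; d) s = eval_straight d (eval_straight c s)"
| "eval_straight (While p c) s = s"

lemma length_eval_straight: "length (eval_straight c s) = length s"
  by (induction c s rule: eval_straight.induct) auto

text \<open>Without loops a program has exactly one state per action and performs each action once,
  so \<open>nst c\<close> is also its running time. Its effect is left to the simplifier.\<close>

lemma reach_straight:
  assumes "straight c" "tapes_below (length s) c" "nst c \<le> T" "eval_straight c s = s'"
  shows "reach c s T s'"
proof -
  have "reach c s (nst c) (eval_straight c s)"
    using assms(1,2)
  proof (induction c arbitrary: s)
    case (Seq c d)
    then show ?case
      using reach_Seq[OF Seq.IH(1)[of s] Seq.IH(2)[of "eval_straight c s"]]
      by (simp add: length_eval_straight)
  qed (auto intro: reach_Act[OF _ refl, unfolded One_nat_def])
  then show ?thesis using assms(3,4) reach_mono by blast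
qed

section \<open>Elementary commands and tapes holding a finite list\<close>

definition right :: "nat \<Rightarrow> com" where "right k = Act k (\<lambda>sy. (sy ! k, MRight))"
definition left :: "nat \<Rightarrow> com" where "left k = Act k (\<lambda>sy. (sy ! k, MLeft))"
definition put :: "nat \<Rightarrow> (nat list \<Rightarrow> nat) \<Rightarrow> com" where "put k f = Act k (\<lambda>sy. (f sy, MRight))"
definition move_if :: "nat \<Rightarrow> move \<Rightarrow> (nat list \<Rightarrow> bool) \<Rightarrow> com" where
  "move_if k m p = Act k (\<lambda>sy. (sy ! k, if p sy then m else MStay))"

text \<open>The head position is any integer and cells off the list are blank, so a sweep may
  overrun either end by one cell and notice it by reading 0.\<close>

definition ltape :: "nat list \<Rightarrow> int \<Rightarrow> tape" where
  "ltape xs h = ((\<lambda>i. if 0 \<le> i \<and> i < int (length xs) then xs ! nat i else 0), h)"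

text \<open>The head stands just behind the list, so writing and moving right appends.\<close>

definition etape :: "nat list \<Rightarrow> tape" where
  "etape xs = ltape xs (int (length xs))"

definition shift :: "int \<Rightarrow> tape \<Rightarrow> tape" where
  "shift d tp = (fst tp, snd tp + d)"

lemma scan_ltape: "scan (ltape xs h) = (if 0 \<le> h \<and> h < int (length xs) then xs ! nat h else 0)"
  by (simp add: ltape_def)

lemma shift_ltape [simp]: "shift d (ltape xs h) = ltape xs (h + d)"
  by (simp add: ltape_def shift_def)

lemma shift_etape [simp]: "shift d (etape xs) = ltape xs (int (length xs) + d)"
  by (simp add: etape_def)

lemma act_scan: "act (scan tp, m) tp = shift (move_offset m) tp"
  by (cases tp) (simp add: shift_def)

lemma act_etape [simp]: "act (a, MRight) (etape xs) = etape (xs @ [a])"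
  by (auto simp: etape_def ltape_def nth_append fun_eq_iff)

lemma eval_right [simp]:
  "k < length s \<Longrightarrow> eval_straight (right k) s = s[k := shift 1 (s ! k)]"
  by (simp add: right_def act_scan)

lemma eval_left [simp]:
  "k < length s \<Longrightarrow> eval_straight (left k) s = s[k := shift (- 1) (s ! k)]"
  by (simp add: left_def act_scan)

lemma eval_put [simp]:
  "eval_straight (put k f) s = s[k := act (f (map scan s), MRight) (s ! k)]"
  by (simp add: put_def)

lemma eval_move_if [simp]:
  "k < length s \<Longrightarrow> eval_straight (move_if k m p) s =
     s[k := shift (if p (map scan s) then move_offset m else 0) (s ! k)]"
  by (simp add: move_if_def act_scan)

lemma straight_basic [simp]:
  "straight (right k)" "straight (left k)" "straight (put k f)" "straight (move_if k m p)"
  by (simp_all add: right_def left_def put_def move_if_def)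

lemma tapes_below_basic [simp]:
  "tapes_below K (right k) = (k < K)" "tapes_below K (left k) = (k < K)"
  "tapes_below K (put k f) = (k < K)" "tapes_below K (move_if k m p) = (k < K)"
  by (simp_all add: right_def left_def put_def move_if_def)

lemma nst_basic [simp]:
  "nst (right k) = 1" "nst (left k) = 1" "nst (put k f) = 1" "nst (move_if k m p) = 1"
  by (simp_all add: right_def left_def put_def move_if_def)

section \<open>The program computing the reduction\<close>

definition put4 :: "nat \<Rightarrow> (nat \<Rightarrow> nat list \<Rightarrow> nat) \<Rightarrow> com" where
  "put4 k f = put k (f 0) ;; put k (f 1) ;; put k (f 2) ;; put k (f 3)"

text \<open>The symbol 2 stands for the bit \<open>True\<close>. The order of the gadget is four
  times the number of objects, so its unary header can be written while the input headers are being
  read.\<close>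

definition read_unary :: "nat \<Rightarrow> com" where
  "read_unary k =
     While (\<lambda>sy. sy ! 0 = 2)
       (right 0 ;; put4 1 (\<lambda>_ _. 2) ;; put 2 (\<lambda>_. k) ;; put 3 (\<lambda>_. k))"

text \<open>Both heads start and finish on the hub mark to the right of the block of
  \<open>k\<close>s. The block on tape 2 drives the outer loop and that on tape 3 the inner one, so
  the square of the block length is counted without arithmetic.\<close>

definition copy_matrix :: "nat \<Rightarrow> com" where
  "copy_matrix k =
     left 2 ;;
     While (\<lambda>sy. sy ! 2 = k)
       (left 3 ;;
        While (\<lambda>sy. sy ! 3 = k) (put 5 (\<lambda>sy. sy ! 0) ;; right 0 ;; left 3) ;;
        right 3 ;;
        While (\<lambda>sy. sy ! 3 = k) (right 3) ;;
        left 2) ;;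
     right 2 ;;
     While (\<lambda>sy. sy ! 2 = k) (right 2)"

definition read_graph :: "nat \<Rightarrow> com" where
  "read_graph k =
     read_unary k ;;
     (right 0 ;; put4 1 (\<lambda>_ _. 2) ;; put 2 (\<lambda>_. Suc k) ;; put 3 (\<lambda>_. Suc k) ;; left 2 ;; left 3) ;;
     copy_matrix k ;;
     (right 2 ;; right 3)"

definition rewind :: "nat \<Rightarrow> com" where
  "rewind k = left k ;; While (\<lambda>sy. sy ! k \<noteq> 0) (left k) ;; right k"

text \<open>A vertex or hub has kind 1 (vertex of the first graph), 2 (hub of the first graph), 3 or 4
  (likewise for the second graph). Only for the pairs of kinds below does the input contain an
  adjacency bit, so that the head of tape 5 moves.\<close>

definition same :: "nat \<Rightarrow> nat \<Rightarrow> bool" where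
  "same k l \<longleftrightarrow> k = l \<and> odd k"

text \<open>Each vertex or hub owns four slots. This decides whether slot \<open>s\<close> of an object of kind \<open>k\<close> is
  adjacent to slot \<open>t\<close> of an object of kind \<open>l\<close>, where \<open>eq\<close> says that the objects are the same and \<open>a\<close>
  that they are adjacent vertices.\<close>

definition cell :: "nat \<Rightarrow> nat \<Rightarrow> nat \<Rightarrow> nat \<Rightarrow> bool \<Rightarrow> bool \<Rightarrow> bool" where
  "cell s t k l eq a \<longleftrightarrow>
     (if odd k then
        if k = l then (eq \<and> (t = Suc s \<or> s = Suc t)) \<or> (a \<and> (s = 0 \<and> t = 3 \<or> s = 3 \<and> t = 0))
        else l = Suc k \<and> s = 0 \<and> t = 0
      else if l = k then (s = 0) \<noteq> (t = 0)
      else k = Suc l \<and> s = 0 \<and> t = 0)"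

text \<open>The four rows of one object consult the same row of the input matrix, so the second loop
  takes back every move of tape 5 made by the first.\<close>

definition write_row :: "nat \<Rightarrow> com" where
  "write_row s =
     While (\<lambda>sy. sy ! 3 \<noteq> 0)
       (put4 1 (\<lambda>t sy. bit_symbol (cell s t (sy ! 2) (sy ! 3) (sy ! 4 \<noteq> 0) (sy ! 5 = 2))) ;;
        move_if 5 MRight (\<lambda>sy. same (sy ! 2) (sy ! 3)) ;; right 3 ;; right 4) ;;
     (left 3 ;; left 4) ;;
     While (\<lambda>sy. sy ! 3 \<noteq> 0)
       (move_if 5 MLeft (\<lambda>sy. same (sy ! 2) (sy ! 3)) ;; left 3 ;; left 4) ;;
     (right 3 ;; right 4)"

text \<open>Here tape 5 is carried across the matrix row and left at its end. The last
  \<open>left 4\<close> accounts for the increased row index.\<close>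

definition next_row :: "com" where
  "next_row =
     While (\<lambda>sy. sy ! 3 \<noteq> 0)
       (move_if 5 MRight (\<lambda>sy. same (sy ! 2) (sy ! 3)) ;; right 3 ;; right 4) ;;
     (left 3 ;; left 4) ;;
     While (\<lambda>sy. sy ! 3 \<noteq> 0) (left 3 ;; left 4) ;;
     (right 3 ;; right 4 ;; right 2 ;; left 4)"

definition write_matrix :: "com" where
  "write_matrix =
     While (\<lambda>sy. sy ! 2 \<noteq> 0)
       (write_row 0 ;; write_row 1 ;; write_row 2 ;; write_row 3 ;; next_row)"

text \<open>The symbol 1 put on tape 1 is the bit \<open>False\<close> that ends the unary header;
  the one put on tape 4 is the mark of the diagonal.\<close>

definition reduction_com :: "com" where
  "reduction_com =
     read_graph 1 ;; read_graph 3 ;;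
     (put 1 (\<lambda>_. 1) ;; put 4 (\<lambda>_. 1) ;; left 4) ;;
     rewind 2 ;; rewind 3 ;; rewind 5 ;;
     write_matrix"

text \<open>Five symbols are needed because the kinds use 1 to 4 beside the blank; the bits reuse 1
  and 2.\<close>

lemma wf_reduction_com: "wf_com 6 5 reduction_com"
proof -
  have "sy ! k < 5" if "k < 6" "length sy = 6" "set sy \<subseteq> {..<5::nat}" for k sy
    using that nth_mem[of k sy] by (metis lessThan_iff subsetD)
  then show ?thesis
    by (auto simp: reduction_com_def read_graph_def read_unary_def copy_matrix_def rewind_def
        write_row_def next_row_def write_matrix_def put4_def put_def right_def left_def move_if_def
        bit_symbol_def)
qed

section \<open>Effect and running time of the reading phase\<close>

lemma replicate_4_mult_Suc: "replicate (4 + 4 * i) x = x # x # x # x # replicate (4 * i) x"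
  by (simp add: replicate_add numeral_eq_Suc)

lemma reach_read_unary:
  assumes inp: "inp = pre @ replicate n 2 @ 1 # rest"
  shows "reach (read_unary k)
     [ltape inp (int (length pre)), etape out, etape ix, etape ix, T4, T5] (Suc (n * 8))
     [ltape inp (int (length pre + n)), etape (out @ replicate (4 * n) 2),
      etape (ix @ replicate n k), etape (ix @ replicate n k), T4, T5]"
proof -
  define S where "S i = [ltape inp (int (length pre + i)), etape (out @ replicate (4 * i) 2),
      etape (ix @ replicate i k), etape (ix @ replicate i k), T4, T5]" for i
  have "reach (read_unary k) (S 0) (Suc (n * Suc 7)) (S n)"
    unfolding read_unary_def
  proof (rule reach_While)
    show "map scan (S i) ! 0 = 2" if "i < n" for i
      using that by (simp add: S_def scan_ltape inp nth_append nat_int_add)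
    show "map scan (S n) ! 0 \<noteq> 2"
      by (simp add: S_def scan_ltape inp nth_append nat_int_add)
    show "reach (right 0 ;; put4 1 (\<lambda>_ _. 2) ;; put 2 (\<lambda>_. k) ;; put 3 (\<lambda>_. k)) (S i) 7 (S (Suc i))"
      if "i < n" for i
      by (rule reach_straight)
        (simp_all add: S_def put4_def replicate_append_same replicate_4_mult_Suc add.commute)
  qed
  then show ?thesis by (simp add: S_def)
qed

text \<open>The ends of the block of \<open>k\<close>s are recognised by reading something else: on
  the right the hub mark \<open>l\<close>, on the left the last entry of \<open>ix\<close> or, if
  \<open>ix\<close> is empty, the blank. Hence the three conditions on \<open>k\<close>.\<close>

lemma reach_copy_matrix:
  assumes ix': "ix' = ix @ replicate n k @ [l]" and k: "k \<notin> set ix" "k \<noteq> l" "k \<noteq> 0"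
    and p: "p + n * n \<le> length inp"
  shows "reach (copy_matrix k)
     [ltape inp (int p), T1, ltape ix' (int (length ix + n)), ltape ix' (int (length ix + n)), T4,
      etape mat] (n * (6 * n + 6) + 2 * n + 4)
     [ltape inp (int (p + n * n)), T1, ltape ix' (int (length ix + n)), ltape ix' (int (length ix + n)),
      T4, etape (mat @ take (n * n) (drop p inp))]"
proof -
  let ?a = "length ix"
  let ?h = "int (length ix + n)"
  have scan_k: "scan (ltape ix' (?h - 1 - int i)) = k" if "i < n" for i
  proof -
    have "nat (?h - 1 - int i) = ?a + (n - 1 - i)" using that by auto
    then show ?thesis using that by (auto simp: scan_ltape ix' nth_append)
  qed
  have scan_end: "scan (ltape ix' (int ?a - 1)) \<noteq> k"
  proof (cases ix)
    case Nil
    then show ?thesis using k by (simp add: scan_ltape)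
  next
    case (Cons x xs)
    then have less: "nat (int ?a - 1) < length ix" by simp
    then have "ix' ! nat (int ?a - 1) = ix ! nat (int ?a - 1)"
      by (simp only: ix' nth_append if_True)
    with less have "ix' ! nat (int ?a - 1) \<noteq> k" using k(1) nth_mem by metis
    then show ?thesis using Cons by (simp add: scan_ltape ix')
  qed
  have scan_end': "scan (ltape ix' (?h - 1 - int n)) \<noteq> k" using scan_end by simp
  have scan_root: "scan (ltape ix' ?h) \<noteq> k"
    using k by (simp add: scan_ltape ix' nth_append nat_int_add)
  have inner: "reach (While (\<lambda>sy. sy ! 3 = k) (put 5 (\<lambda>sy. sy ! 0) ;; right 0 ;; left 3))
      [ltape inp (int q), T1, T2, ltape ix' (?h - 1), T4, etape mt] (Suc (n * Suc 3))
      [ltape inp (int (q + n)), T1, T2, ltape ix' (int ?a - 1), T4, etape (mt @ take n (drop q inp))]"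
    if "q + n \<le> length inp" for q mt T2
  proof -
    define S where "S i = [ltape inp (int (q + i)), T1, T2, ltape ix' (?h - 1 - int i), T4,
        etape (mt @ take i (drop q inp))]" for i
    have "reach (While (\<lambda>sy. sy ! 3 = k) (put 5 (\<lambda>sy. sy ! 0) ;; right 0 ;; left 3)) (S 0)
        (Suc (n * Suc 3)) (S n)"
    proof (rule reach_While)
      show "map scan (S i) ! 3 = k" if "i < n" for i
        using scan_k[OF that] by (simp add: S_def)
      show "map scan (S n) ! 3 \<noteq> k"
        using scan_end' by (simp add: S_def)
      show "reach (put 5 (\<lambda>sy. sy ! 0) ;; right 0 ;; left 3) (S i) 3 (S (Suc i))" if i: "i < n" for i
      proof (rule reach_straight)
        have "q + i < length inp" using i \<open>q + n \<le> length inp\<close> by simp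
        then have "take (Suc i) (drop q inp) = take i (drop q inp) @ [inp ! (q + i)]"
          by (simp add: take_Suc_conv_app_nth)
        moreover have "nat (int q + int i) = q + i" by simp
        ultimately show "eval_straight (put 5 (\<lambda>sy. sy ! 0) ;; right 0 ;; left 3) (S i) = S (Suc i)"
          using \<open>q + i < length inp\<close> by (simp add: S_def scan_ltape algebra_simps)
      qed (simp_all add: S_def)
    qed
    then show ?thesis by (simp add: S_def algebra_simps)
  qed
  have back3: "reach (While (\<lambda>sy. sy ! 3 = k) (right 3))
      [T0, T1, T2, ltape ix' (int ?a), T4, T5] (Suc (n * Suc 1)) [T0, T1, T2, ltape ix' ?h, T4, T5]"
    for T0 T2 T5
  proof -
    define S where "S i = [T0, T1, T2, ltape ix' (int (?a + i)), T4, T5]" for i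
    have "reach (While (\<lambda>sy. sy ! 3 = k) (right 3)) (S 0) (Suc (n * Suc 1)) (S n)"
    proof (rule reach_While)
      show "map scan (S i) ! 3 = k" if "i < n" for i
        using that by (auto simp: S_def scan_ltape ix' nth_append)
      show "map scan (S n) ! 3 \<noteq> k" using scan_root by (simp add: S_def)
      show "reach (right 3) (S i) 1 (S (Suc i))" for i
        by (rule reach_straight) (simp_all add: S_def add.commute)
    qed
    then show ?thesis by (simp add: S_def)
  qed
  have back2: "reach (While (\<lambda>sy. sy ! 2 = k) (right 2))
      [T0, T1, ltape ix' (int ?a), T3, T4, T5] (Suc (n * Suc 1)) [T0, T1, ltape ix' ?h, T3, T4, T5]"
    for T0 T3 T5
  proof -
    define S where "S i = [T0, T1, ltape ix' (int (?a + i)), T3, T4, T5]" for i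
    have "reach (While (\<lambda>sy. sy ! 2 = k) (right 2)) (S 0) (Suc (n * Suc 1)) (S n)"
    proof (rule reach_While)
      show "map scan (S i) ! 2 = k" if "i < n" for i
        using that by (auto simp: S_def scan_ltape ix' nth_append)
      show "map scan (S n) ! 2 \<noteq> k" using scan_root by (simp add: S_def)
      show "reach (right 2) (S i) 1 (S (Suc i))" for i
        by (rule reach_straight) (simp_all add: S_def add.commute)
    qed
    then show ?thesis by (simp add: S_def)
  qed
  define S where "S i = [ltape inp (int (p + i * n)), T1, ltape ix' (?h - 1 - int i), ltape ix' ?h, T4,
        etape (mat @ take (i * n) (drop p inp))]" for i
  let ?body = "left 3 ;; While (\<lambda>sy. sy ! 3 = k) (put 5 (\<lambda>sy. sy ! 0) ;; right 0 ;; left 3) ;;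
        right 3 ;; While (\<lambda>sy. sy ! 3 = k) (right 3) ;; left 2"
  have outer: "reach (While (\<lambda>sy. sy ! 2 = k) ?body) (S 0) (Suc (n * Suc (6 * n + 5))) (S n)"
  proof (rule reach_While)
    show "map scan (S i) ! 2 = k" if "i < n" for i
      using scan_k[OF that] by (simp add: S_def)
    show "map scan (S n) ! 2 \<noteq> k"
      using scan_end' by (simp add: S_def)
    show "reach ?body (S i) (6 * n + 5) (S (Suc i))" if i: "i < n" for i
    proof -
      let ?q = "p + i * n"
      have "Suc i * n \<le> n * n" using i by (intro mult_le_mono) auto
      then have q: "?q + n \<le> length inp" using p by simp
      have take: "take (n + i * n) (drop p inp) = take (i * n) (drop p inp) @ take n (drop ?q inp)"
        using take_add[of "i * n" n "drop p inp"] by (simp add: add.commute)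
      let ?m = "mat @ take (i * n) (drop p inp)"
      have 1: "reach (left 3) (S i) 1 [ltape inp (int ?q), T1, ltape ix' (?h - 1 - int i),
          ltape ix' (?h - 1), T4, etape ?m]"
        by (rule reach_straight) (simp_all add: S_def)
      have 2: "reach (right 3) [ltape inp (int (?q + n)), T1, ltape ix' (?h - 1 - int i),
          ltape ix' (int ?a - 1), T4, etape (?m @ take n (drop ?q inp))] 1
        [ltape inp (int (?q + n)), T1, ltape ix' (?h - 1 - int i),
          ltape ix' (int ?a), T4, etape (?m @ take n (drop ?q inp))]"
        by (rule reach_straight) simp_all
      have 3: "reach (left 2) [ltape inp (int (?q + n)), T1, ltape ix' (?h - 1 - int i),
          ltape ix' ?h, T4, etape (?m @ take n (drop ?q inp))] 1 (S (Suc i))"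
        by (rule reach_straight) (simp_all add: S_def take algebra_simps)
      show ?thesis
        by (rule reach_mono[OF reach_Seq[OF 1 reach_Seq[OF inner[OF q]
              reach_Seq[OF 2 reach_Seq[OF back3 3]]]]]) simp
    qed
  qed
  show ?thesis
    unfolding copy_matrix_def
    by (rule reach_mono[OF reach_Seq[OF _ reach_Seq[OF outer reach_Seq[OF _ back2]]]],
        rule reach_straight[OF _ _ order_refl], simp, simp, simp add: S_def,
        unfold S_def, rule reach_straight[OF _ _ order_refl], simp, simp, simp, simp)
qed


lemma reach_read_graph:
  assumes inp: "inp = pre @ replicate n 2 @ 1 # bits @ post" and len: "length bits = n * n"
    and k: "k \<notin> set ix" "k \<noteq> 0"
  shows "reach (read_graph k)
     [ltape inp (int (length pre)), etape out, etape ix, etape ix, T4, etape mat]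
     (6 * n * n + 16 * n + 20)
     [ltape inp (int (length (pre @ replicate n 2 @ 1 # bits))), etape (out @ replicate (4 * Suc n) 2),
      etape (ix @ replicate n k @ [Suc k]), etape (ix @ replicate n k @ [Suc k]), T4, etape (mat @ bits)]"
proof -
  let ?ix = "ix @ replicate n k @ [Suc k]" and ?p = "length pre + Suc n"
  have root: "reach (right 0 ;; put4 1 (\<lambda>_ _. 2) ;; put 2 (\<lambda>_. Suc k) ;; put 3 (\<lambda>_. Suc k) ;; left 2 ;; left 3)
     [ltape inp (int (length pre + n)), etape (out @ replicate (4 * n) 2),
      etape (ix @ replicate n k), etape (ix @ replicate n k), T4, etape mat] 9
     [ltape inp (int ?p), etape (out @ replicate (4 * Suc n) 2),
      ltape ?ix (int (length ix + n)), ltape ?ix (int (length ix + n)), T4, etape mat]"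
    by (rule reach_straight) (simp_all add: put4_def replicate_append_same replicate_4_mult_Suc add.commute)
  have bits: "take (n * n) (drop ?p inp) = bits"
    by (simp add: inp len)
  have copy: "reach (copy_matrix k)
     [ltape inp (int ?p), etape (out @ replicate (4 * Suc n) 2),
      ltape ?ix (int (length ix + n)), ltape ?ix (int (length ix + n)), T4, etape mat]
     (n * (6 * n + 6) + 2 * n + 4)
     [ltape inp (int (?p + n * n)), etape (out @ replicate (4 * Suc n) 2),
      ltape ?ix (int (length ix + n)), ltape ?ix (int (length ix + n)), T4, etape (mat @ bits)]"
    using reach_copy_matrix[OF refl k(1) _ k(2), of "Suc k" ?p n inp] bits
    by (simp add: inp len)
  have last: "reach (right 2 ;; right 3)
     [T0, T1, ltape ?ix (int (length ix + n)), ltape ?ix (int (length ix + n)), T4, T5] 2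
     [T0, T1, etape ?ix, etape ?ix, T4, T5]" for T0 T1 T5
    by (rule reach_straight) (simp_all add: etape_def add_ac)
  show ?thesis
    unfolding read_graph_def
    by (rule reach_mono, insert reach_Seq[OF reach_read_unary[OF inp] reach_Seq[OF root
          reach_Seq[OF copy last]]], simp add: len add_ac)
      (simp add: algebra_simps)
qed

lemma reach_rewind:
  assumes "k < length s" "s ! k = etape xs" "0 \<notin> set xs"
  shows "reach (rewind k) s (2 * length xs + 3) (s[k := ltape xs 0])"
proof -
  let ?n = "length xs"
  define S where "S i = s[k := ltape xs (int ?n - 1 - int i)]" for i
  have 1: "reach (left k) s 1 (S 0)"
    by (rule reach_straight) (use assms in \<open>simp_all add: S_def\<close>)
  have 2: "reach (While (\<lambda>sy. sy ! k \<noteq> 0) (left k)) (S 0) (Suc (?n * Suc 1)) (S ?n)"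
  proof (rule reach_While)
    show "map scan (S i) ! k \<noteq> 0" if "i < ?n" for i
    proof -
      have "nat (int ?n - 1 - int i) < ?n" using that by auto
      then have "xs ! nat (int ?n - 1 - int i) \<noteq> 0" using assms(3) nth_mem by metis
      then show ?thesis using that assms(1) by (simp add: S_def scan_ltape)
    qed
    show "\<not> map scan (S ?n) ! k \<noteq> 0" using assms(1) by (simp add: S_def scan_ltape)
    show "reach (left k) (S i) 1 (S (Suc i))" for i
      by (rule reach_straight) (use assms(1) in \<open>simp_all add: S_def algebra_simps\<close>)
  qed
  have 3: "reach (right k) (S ?n) 1 (s[k := ltape xs 0])"
    by (rule reach_straight) (use assms(1) in \<open>simp_all add: S_def\<close>)
  show ?thesis
    unfolding rewind_def by (rule reach_mono[OF reach_Seq[OF 1 reach_Seq[OF 2 3]]]) simp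
qed

section \<open>Effect and running time of the writing phase\<close>

text \<open>\<open>pos i j\<close> is the head position on tape 5 when the machine is in row \<open>i\<close> and column \<open>j\<close>.\<close>

locale matrix_writer =
  fixes ix mat :: "nat list" and pos :: "nat \<Rightarrow> nat \<Rightarrow> nat"
  assumes nonzero: "0 \<notin> set ix"
    and pos_Suc: "\<And>i j. i < length ix \<Longrightarrow> j < length ix \<Longrightarrow>
      pos i (Suc j) = pos i j + (if same (ix ! i) (ix ! j) then 1 else 0)"
    and pos_next: "\<And>i. i < length ix \<Longrightarrow> pos (Suc i) 0 = pos i (length ix)"
    and pos_less: "\<And>i j. i < length ix \<Longrightarrow> j < length ix \<Longrightarrow> same (ix ! i) (ix ! j) \<Longrightarrow>
      pos i j < length mat"
begin

abbreviation "L \<equiv> length ix"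

definition entry :: "nat \<Rightarrow> nat \<Rightarrow> nat \<Rightarrow> nat \<Rightarrow> bool" where
  "entry i s j t = cell s t (ix ! i) (ix ! j) (i = j)
     (same (ix ! i) (ix ! j) \<and> mat ! pos i j = 2)"

definition block :: "nat \<Rightarrow> nat \<Rightarrow> nat \<Rightarrow> nat list" where
  "block i s j = map (\<lambda>t. bit_symbol (entry i s j t)) [0..<4]"

text \<open>The column \<open>j\<close> is an integer because the sweeps to the left end at column
  -1. The head of tape 4 is kept at column minus row, with the mark in cell 0.\<close>

definition state :: "tape \<Rightarrow> nat list \<Rightarrow> nat \<Rightarrow> int \<Rightarrow> nat \<Rightarrow> tape list" where
  "state T out i j q = [T, etape out, ltape ix (int i), ltape ix j, ltape [1] (j - int i), ltape mat (int q)]"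

lemma scan_ix: "i < L \<Longrightarrow> scan (ltape ix (int i)) = ix ! i"
  by (simp add: scan_ltape)

lemma ix_nonzero: "i < L \<Longrightarrow> ix ! i \<noteq> 0"
  using nonzero nth_mem by metis

text \<open>\<open>cell\<close> consults the adjacency argument only for equal odd kinds, so the
  machine may hand it whatever symbol lies under the head of tape 5.\<close>

lemma cell_same: "cell s t k l e (same k l \<and> a) = cell s t k l e a"
  by (auto simp: cell_def same_def)

lemma write_cell:
  assumes "i < L" "j < L"
  shows "reach (put4 1 (\<lambda>t sy. bit_symbol (cell s t (sy ! 2) (sy ! 3) (sy ! 4 \<noteq> 0) (sy ! 5 = 2))) ;;
        move_if 5 MRight (\<lambda>sy. same (sy ! 2) (sy ! 3)) ;; right 3 ;; right 4)
     (state T out i (int j) (pos i j)) 7 (state T (out @ block i s j) i (int (Suc j)) (pos i (Suc j)))"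
proof -
  have dot: "scan (ltape [1] (int j - int i)) \<noteq> 0 \<longleftrightarrow> i = j"
    by (auto simp: scan_ltape)
  have bit: "cell s t (ix ! i) (ix ! j) (i = j) (scan (ltape mat (int (pos i j))) = 2) = entry i s j t" for t
  proof (cases "same (ix ! i) (ix ! j)")
    case True
    then show ?thesis using pos_less[OF assms] by (simp add: entry_def scan_ltape)
  next
    case False
    then show ?thesis unfolding entry_def by (subst cell_same[symmetric]) simp
  qed
  have block: "block i s j = [bit_symbol (entry i s j 0), bit_symbol (entry i s j 1),
      bit_symbol (entry i s j 2), bit_symbol (entry i s j 3)]"
    by (simp add: block_def numeral_eq_Suc)
  show ?thesis
    by (cases "same (ix ! i) (ix ! j)"; rule reach_straight)
      (use assms in \<open>simp_all add: state_def put4_def scan_ix block pos_Suc bit dot[simplified]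
          algebra_simps\<close>)
qed

lemma reach_write_row:
  assumes i: "i < L"
  shows "reach (write_row s) (state T out i 0 (pos i 0)) (12 * L + 6)
    (state T (out @ concat (map (block i s) [0..<L])) i 0 (pos i 0))"
proof -
  define S where "S j = state T (out @ concat (map (block i s) [0..<j])) i (int j) (pos i j)" for j
  have 1: "reach (While (\<lambda>sy. sy ! 3 \<noteq> 0)
       (put4 1 (\<lambda>t sy. bit_symbol (cell s t (sy ! 2) (sy ! 3) (sy ! 4 \<noteq> 0) (sy ! 5 = 2))) ;;
        move_if 5 MRight (\<lambda>sy. same (sy ! 2) (sy ! 3)) ;; right 3 ;; right 4))
      (S 0) (Suc (L * Suc 7)) (S L)"
  proof (rule reach_While)
    show "map scan (S j) ! 3 \<noteq> 0" if "j < L" for j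
      using ix_nonzero[OF that] that by (simp add: S_def state_def scan_ix)
    show "\<not> map scan (S L) ! 3 \<noteq> 0" by (simp add: S_def state_def scan_ltape)
  next
    fix j assume "j < L"
    from write_cell[OF i this, of s T "out @ concat (map (block i s) [0..<j])"] show "reach (put4 1 (\<lambda>t sy. bit_symbol (cell s t (sy ! 2) (sy ! 3) (sy ! 4 \<noteq> 0) (sy ! 5 = 2))) ;;
        move_if 5 MRight (\<lambda>sy. same (sy ! 2) (sy ! 3)) ;; right 3 ;; right 4) (S j) 7 (S (Suc j))"
      by (simp add: S_def)
  qed
  let ?out = "out @ concat (map (block i s) [0..<L])"
  \<comment> \<open>The column head scans \<open>L - 1 - d\<close> while tape 5 is still at the
    position reached after that column; the loop body undoes exactly this move.\<close>
  define R where "R d = state T ?out i (int L - 1 - int d) (pos i (L - d))" for d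
  have 2: "reach (left 3 ;; left 4) (S L) 2 (R 0)"
    by (rule reach_straight) (simp_all add: S_def R_def state_def algebra_simps)
  have 3: "reach (While (\<lambda>sy. sy ! 3 \<noteq> 0)
       (move_if 5 MLeft (\<lambda>sy. same (sy ! 2) (sy ! 3)) ;; left 3 ;; left 4))
       (R 0) (Suc (L * Suc 3)) (R L)"
  proof (rule reach_While)
    fix d assume d: "d < L"
    define j where "j = L - Suc d"
    have j: "j < L" "int L - 1 - int d = int j" "L - d = Suc j" "L - Suc d = j"
      "int L - 1 - int (Suc d) = int j - 1"
      using d by (auto simp: j_def)
    show "map scan (R d) ! 3 \<noteq> 0"
      using ix_nonzero[OF j(1)] j(1) by (simp add: R_def j(2) state_def scan_ix)
    show "reach (move_if 5 MLeft (\<lambda>sy. same (sy ! 2) (sy ! 3)) ;; left 3 ;; left 4) (R d) 3 (R (Suc d))"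
      unfolding R_def j
      by (rule reach_straight)
        (use i j(1) in \<open>simp_all add: state_def scan_ix pos_Suc algebra_simps\<close>)
  next
    show "\<not> map scan (R L) ! 3 \<noteq> 0" by (simp add: R_def state_def scan_ltape)
  qed
  have 4: "reach (right 3 ;; right 4) (R L) 2 (state T ?out i 0 (pos i 0))"
    by (rule reach_straight) (simp_all add: R_def state_def algebra_simps)
  have S0: "state T out i 0 (pos i 0) = S 0" by (simp add: S_def)
  show ?thesis
    unfolding write_row_def S0
    by (rule reach_mono[OF reach_Seq[OF 1 reach_Seq[OF 2 reach_Seq[OF 3 4]]]]) simp
qed

lemma reach_next_row:
  assumes i: "i < L"
  shows "reach next_row (state T out i 0 (pos i 0)) (7 * L + 8)
    (state T out (Suc i) 0 (pos (Suc i) 0))"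
proof -
  define S where "S j = state T out i (int j) (pos i j)" for j
  have 1: "reach (While (\<lambda>sy. sy ! 3 \<noteq> 0)
       (move_if 5 MRight (\<lambda>sy. same (sy ! 2) (sy ! 3)) ;; right 3 ;; right 4))
      (S 0) (Suc (L * Suc 3)) (S L)"
  proof (rule reach_While)
    show "map scan (S j) ! 3 \<noteq> 0" if "j < L" for j
      using ix_nonzero[OF that] that by (simp add: S_def state_def scan_ix)
    show "\<not> map scan (S L) ! 3 \<noteq> 0" by (simp add: S_def state_def scan_ltape)
  next
    fix j assume "j < L"
    then show "reach (move_if 5 MRight (\<lambda>sy. same (sy ! 2) (sy ! 3)) ;; right 3 ;; right 4) (S j) 3 (S (Suc j))"
      by (intro reach_straight) (use i in \<open>simp_all add: S_def state_def scan_ix pos_Suc algebra_simps\<close>)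
  qed
  \<comment> \<open>On this way back tape 5 rests at \<open>pos i L\<close>, which by
    \<open>pos_next\<close> is the beginning of the next row.\<close>
  define R where "R d = state T out i (int L - 1 - int d) (pos i L)" for d
  have 2: "reach (left 3 ;; left 4) (S L) 2 (R 0)"
    by (rule reach_straight) (simp_all add: S_def R_def state_def algebra_simps)
  have 3: "reach (While (\<lambda>sy. sy ! 3 \<noteq> 0) (left 3 ;; left 4)) (R 0) (Suc (L * Suc 2)) (R L)"
  proof (rule reach_While)
    fix d assume d: "d < L"
    define j where "j = L - Suc d"
    have j: "j < L" "int L - 1 - int d = int j" "int L - 1 - int (Suc d) = int j - 1"
      using d by (auto simp: j_def)
    show "map scan (R d) ! 3 \<noteq> 0"
      using ix_nonzero[OF j(1)] j(1) by (simp add: R_def j(2) state_def scan_ix)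
    show "reach (left 3 ;; left 4) (R d) 2 (R (Suc d))"
      unfolding R_def j by (rule reach_straight) (simp_all add: state_def algebra_simps)
  next
    show "\<not> map scan (R L) ! 3 \<noteq> 0" by (simp add: R_def state_def scan_ltape)
  qed
  have 4: "reach (right 3 ;; right 4 ;; right 2 ;; left 4) (R L) 4 (state T out (Suc i) 0 (pos (Suc i) 0))"
    by (rule reach_straight) (use pos_next[OF i] in \<open>simp_all add: R_def state_def algebra_simps\<close>)
  have S0: "state T out i 0 (pos i 0) = S 0" by (simp add: S_def)
  show ?thesis
    unfolding next_row_def S0
    by (rule reach_mono[OF reach_Seq[OF 1 reach_Seq[OF 2 reach_Seq[OF 3 4]]]]) simp
qed

definition rows :: "nat \<Rightarrow> nat list" where
  "rows i = concat (map (\<lambda>s. concat (map (block i s) [0..<L])) [0..<4])"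

lemma reach_write_matrix:
  "reach write_matrix (state T out 0 0 (pos 0 0)) (L * (55 * L + 33) + 1)
    (state T (out @ concat (map rows [0..<L])) L 0 (pos L 0))"
proof -
  define S where "S i = state T (out @ concat (map rows [0..<i])) i 0 (pos i 0)" for i
  have "reach write_matrix (S 0) (Suc (L * Suc (55 * L + 32))) (S L)"
    unfolding write_matrix_def
  proof (rule reach_While)
    show "map scan (S i) ! 2 \<noteq> 0" if "i < L" for i
      using ix_nonzero[OF that] that by (simp add: S_def state_def scan_ix)
    show "\<not> map scan (S L) ! 2 \<noteq> 0" by (simp add: S_def state_def scan_ltape)
  next
    fix i assume i: "i < L"
    have Suc_i: "S (Suc i) = state T (((((out @ concat (map rows [0..<i])) @ concat (map (block i 0) [0..<L])) @
        concat (map (block i 1) [0..<L])) @ concat (map (block i 2) [0..<L])) @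
        concat (map (block i 3) [0..<L])) (Suc i) 0 (pos (Suc i) 0)"
      by (simp add: S_def rows_def numeral_eq_Suc)
    show "reach (write_row 0 ;; write_row 1 ;; write_row 2 ;; write_row 3 ;; next_row) (S i)
        (55 * L + 32) (S (Suc i))"
      unfolding Suc_i unfolding S_def
      by (rule reach_mono[OF reach_Seq[OF reach_write_row[OF i] reach_Seq[OF reach_write_row[OF i]
          reach_Seq[OF reach_write_row[OF i] reach_Seq[OF reach_write_row[OF i] reach_next_row[OF i]]]]]])
        simp
  qed
  then show ?thesis by (simp add: S_def add.commute)
qed

end


section \<open>The gadget graph\<close>

definition kind :: "nat \<Rightarrow> nat \<Rightarrow> nat \<Rightarrow> nat" where
  "kind n m i = (if i < n then 1 else if i = n then 2 else if i < n + 1 + m then 3 else 4)"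

definition linked :: "graph \<Rightarrow> graph \<Rightarrow> nat \<Rightarrow> nat \<Rightarrow> bool" where
  "linked G H i j \<longleftrightarrow>
     (i < fst G \<and> j < fst G \<and> {i, j} \<in> edges G) \<or>
     (fst G < i \<and> i < fst G + 1 + fst H \<and> fst G < j \<and> j < fst G + 1 + fst H \<and>
        {i - (fst G + 1), j - (fst G + 1)} \<in> edges H)"

text \<open>Slot \<open>s\<close> of the object with index \<open>i\<close> is the vertex \<open>4 * i + s\<close>; the indices run through the vertices
  of \<open>G\<close>, the hub of \<open>G\<close>, the vertices of \<open>H\<close> and the hub of \<open>H\<close>.\<close>

definition gadget_adj :: "graph \<Rightarrow> graph \<Rightarrow> nat \<Rightarrow> nat \<Rightarrow> bool" where
  "gadget_adj G H u v \<longleftrightarrow>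
     cell (u mod 4) (v mod 4) (kind (fst G) (fst H) (u div 4)) (kind (fst G) (fst H) (v div 4))
       (u div 4 = v div 4) (linked G H (u div 4) (v div 4))"

definition gadget_order :: "graph \<Rightarrow> graph \<Rightarrow> nat" where
  "gadget_order G H = 4 * (fst G + fst H + 2)"

definition gadget :: "graph \<Rightarrow> graph \<Rightarrow> graph" where
  "gadget G H = (gadget_order G H,
     {{u, v} | u v. u < gadget_order G H \<and> v < gadget_order G H \<and> gadget_adj G H u v})"

lemma linked_sym: "linked G H i j = linked G H j i"
  by (auto simp: linked_def insert_commute)

lemma cell_sym: "cell s t k l e a = cell t s l k e a"
  by (auto simp: cell_def)

lemma gadget_adj_sym: "gadget_adj G H u v = gadget_adj G H v u"
  unfolding gadget_adj_def
  by (subst cell_sym, subst linked_sym, subst eq_commute[of "u div 4"]) (rule refl)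

lemma edges_gadget:
  assumes "u < gadget_order G H" "v < gadget_order G H"
  shows "{u, v} \<in> edges (gadget G H) \<longleftrightarrow> gadget_adj G H u v"
  using assms gadget_adj_sym[of G H] by (auto simp: edges_def gadget_def doubleton_eq_iff)

section \<open>Adjacency in the gadget, slot by slot\<close>

locale graph_pair =
  fixes G H :: graph
  assumes simple_G: "simple_graph G" and simple_H: "simple_graph H"
begin

abbreviation "n \<equiv> fst G"
abbreviation "m \<equiv> fst H"

definition P :: "nat \<Rightarrow> nat \<Rightarrow> bool" where
  "P u v \<longleftrightarrow> u < gadget_order G H \<and> v < gadget_order G H \<and> gadget_adj G H u v"

definition normal :: "nat \<Rightarrow> bool" where
  "normal i \<longleftrightarrow> i < n + 1 + m \<and> i \<noteq> n"

text \<open>At a hub \<open>root\<close> is the identity, so on all objects its value names the half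
  in which the object lies.\<close>

definition root :: "nat \<Rightarrow> nat" where
  "root i = (if i \<le> n then n else n + 1 + m)"

lemma linked_irrefl: "\<not> linked G H i i"
  using simple_G simple_H by (auto simp: linked_def simple_graph_def doubleton_eq_iff)

lemma linked_normal: "linked G H i j \<Longrightarrow> normal i \<and> normal j \<and> root i = root j"
  by (auto simp: linked_def normal_def root_def)

lemma not_normal_root: "\<not> normal (root i)"
  by (auto simp: normal_def root_def)

text \<open>Leads from the numeric kinds of the machine to the combinatorial description: an index
  in range is \<open>normal\<close> exactly if its kind is odd, and consecutive kinds belong to a
  vertex and the hub of its own half.\<close>

lemma P_iff:
  assumes "s < 4" "t < 4"
  shows "P (4 * i + s) (4 * j + t) \<longleftrightarrow> i < n + m + 2 \<and> j < n + m + 2 \<and>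
    (if normal i then
       if normal j then (i = j \<and> (t = Suc s \<or> s = Suc t)) \<or>
         (linked G H i j \<and> (s = 0 \<and> t = 3 \<or> s = 3 \<and> t = 0))
       else j = root i \<and> s = 0 \<and> t = 0
     else if normal j then i = root j \<and> s = 0 \<and> t = 0
     else i = j \<and> (s = 0) \<noteq> (t = 0))"
proof -
  have "4 * i + s < gadget_order G H \<longleftrightarrow> i < n + m + 2" "4 * j + t < gadget_order G H \<longleftrightarrow> j < n + m + 2"
    using assms by (auto simp: gadget_order_def)
  then have "P (4 * i + s) (4 * j + t) \<longleftrightarrow> i < n + m + 2 \<and> j < n + m + 2 \<and>
      cell s t (kind n m i) (kind n m j) (i = j) (linked G H i j)"
    using assms by (simp add: P_def gadget_adj_def)
  then show ?thesis
    by (auto simp: cell_def kind_def normal_def root_def linked_def)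
qed

lemma vertex_cases:
  obtains i where "u = 4 * i" | i where "u = 4 * i + 1" | i where "u = 4 * i + 2"
    | i where "u = 4 * i + (3::nat)"
proof -
  have "u = 4 * (u div 4) + u mod 4" "u mod 4 < 4" by auto
  then have "u = 4 * (u div 4) \<or> u = 4 * (u div 4) + 1 \<or> u = 4 * (u div 4) + 2 \<or> u = 4 * (u div 4) + 3"
    by linarith
  then show thesis using that by blast
qed

text \<open>Terms such as \<open>4 * i\<close> do not match the pattern of \<open>P_iff\<close>
  syntactically, so rewriting needs the sixteen instances.\<close>

lemmas P_slots = P_iff[of 0 0, simplified] P_iff[of 0 1, simplified] P_iff[of 0 2, simplified]
  P_iff[of 0 3, simplified] P_iff[of 1 0, simplified] P_iff[of 1 1, simplified]
  P_iff[of 1 2, simplified] P_iff[of 1 3, simplified] P_iff[of 2 0, simplified]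
  P_iff[of 2 1, simplified] P_iff[of 2 2, simplified] P_iff[of 2 3, simplified]
  P_iff[of 3 0, simplified] P_iff[of 3 1, simplified] P_iff[of 3 2, simplified]
  P_iff[of 3 3, simplified]

lemma P_sym: "P u v \<Longrightarrow> P v u"
  by (simp add: P_def gadget_adj_sym)

section \<open>Invariant properties that identify the slots\<close>

definition leaf :: "nat \<Rightarrow> bool" where
  "leaf x \<longleftrightarrow> (\<exists>y. P x y \<and> (\<forall>z. P x z \<longrightarrow> z = y))"

definition hub :: "nat \<Rightarrow> bool" where
  "hub r \<longleftrightarrow> (\<exists>x y. x \<noteq> y \<and> P r x \<and> P r y \<and> leaf x \<and> leaf y)"

text \<open>Keeps the walks in \<open>joined\<close> from passing through a hub or through slot 0 of
  a third vertex.\<close>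

definition core :: "nat \<Rightarrow> bool" where
  "core x \<longleftrightarrow> \<not> hub x \<and> (\<forall>r. hub r \<longrightarrow> \<not> P r x)"

text \<open>The condition \<open>a \<noteq> c\<close> excludes the walk with inner slots 3, 2, 3 of
  a common neighbour, which would join vertices at distance two.\<close>

definition joined :: "nat \<Rightarrow> nat \<Rightarrow> bool" where
  "joined x y \<longleftrightarrow> (\<exists>a b c. a \<noteq> c \<and> core a \<and> core b \<and> core c \<and> P x a \<and> P a b \<and> P b c \<and> P c y)"

lemma not_leafI: "P x y \<Longrightarrow> P x z \<Longrightarrow> y \<noteq> z \<Longrightarrow> \<not> leaf x"
  by (auto simp: leaf_def)

lemma normal_less: "normal i \<Longrightarrow> i < n + m + 2" "root i < n + m + 2"
  by (auto simp: normal_def root_def)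

lemma not_leaf_slots:
  assumes "normal i"
  shows "\<not> leaf (4 * i)" "\<not> leaf (4 * i + 1)" "\<not> leaf (4 * i + 2)"
proof -
  note [simp] = P_slots assms normal_less(1)[OF assms, simplified] normal_less(2)[simplified] not_normal_root
  show "\<not> leaf (4 * i)"
    by (rule not_leafI[of _ "4 * i + 1" "4 * root i"]) (simp, simp, presburger)
  show "\<not> leaf (4 * i + 1)"
    by (rule not_leafI[of _ "4 * i" "4 * i + 2"]) simp_all
  show "\<not> leaf (4 * i + 2)"
    by (rule not_leafI[of _ "4 * i + 1" "4 * i + 3"]) simp_all
qed

lemma leaf_root:
  assumes "i < n + m + 2" "\<not> normal i" "0 < s" "s < 4"
  shows "leaf (4 * i + s)"
  unfolding leaf_def
proof (intro exI conjI allI impI)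
  show "P (4 * i + s) (4 * i)"
    using P_iff[of s 0 i i] assms by simp
  fix z assume z: "P (4 * i + s) z"
  have "z = 4 * (z div 4) + z mod 4" "z mod 4 < 4" by auto
  then show "z = 4 * i"
    using P_iff[of s "z mod 4" i "z div 4"] assms z by (auto split: if_splits)
qed

lemma leaf_unique: "leaf x \<Longrightarrow> P x y \<Longrightarrow> P x z \<Longrightarrow> y = z"
  by (auto simp: leaf_def)

lemma leaf_nbr:
  assumes z: "leaf z" "P z y"
  shows "(\<exists>k. z = 4 * k + 3 \<and> y = 4 * k + 2) \<or> (\<exists>k. \<not> normal k \<and> k < n + m + 2 \<and> y = 4 * k)"
proof -
  have less: "z div 4 < n + m + 2" using z(2) by (auto simp: P_def gadget_order_def)
  show ?thesis
  proof (cases z rule: vertex_cases)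
    case (1 k)
    have "\<not> leaf (4 * k)" if "\<not> normal k"
      by (rule not_leafI[of _ "4 * k + 1" "4 * k + 2"]) (use that less 1 in \<open>simp_all add: P_slots\<close>)
    then show ?thesis using not_leaf_slots(1) z(1) 1 by blast
  next
    case (2 k)
    then have "\<not> normal k" using not_leaf_slots(2) z(1) by blast
    moreover from this have "P z (4 * k)" using 2 less by (simp add: P_slots)
    ultimately show ?thesis using leaf_unique[OF z] 2 less by auto
  next
    case (3 k)
    then have "\<not> normal k" using not_leaf_slots(3) z(1) by blast
    moreover from this have "P z (4 * k)" using 3 less by (simp add: P_slots)
    ultimately show ?thesis using leaf_unique[OF z] 3 less by auto
  next
    case (4 k)
    show ?thesis
    proof (cases "normal k")
      case True
      then have "P z (4 * k + 2)" using 4 less by (simp add: P_slots)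
      then show ?thesis using leaf_unique[OF z] 4 by blast
    next
      case False
      then have "P z (4 * k)" using 4 less by (simp add: P_slots)
      then show ?thesis using leaf_unique[OF z] False 4 less by auto
    qed
  qed
qed

text \<open>In the first alternative of \<open>leaf_nbr\<close> the neighbour determines the leaf,
  so two different leaves can only share a hub.\<close>

lemma hub_iff: "hub r \<longleftrightarrow> r = 4 * n \<or> r = 4 * (n + 1 + m)"
proof
  assume "r = 4 * n \<or> r = 4 * (n + 1 + m)"
  then obtain i where "r = 4 * i" "i = n \<or> i = n + 1 + m" by blast
  then have i: "r = 4 * i" "\<not> normal i" "i < n + m + 2"
    by (auto simp: normal_def)
  then show "hub r"
    unfolding hub_def using leaf_root[OF i(3,2), of 1] leaf_root[OF i(3,2), of 2]
    by (intro exI[of _ "4 * i + 1"] exI[of _ "4 * i + 2"]) (simp add: P_slots)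
next
  assume "hub r"
  then obtain x y where xy: "x \<noteq> y" "P r x" "P r y" "leaf x" "leaf y"
    by (auto simp: hub_def)
  show "r = 4 * n \<or> r = 4 * (n + 1 + m)"
  proof (rule ccontr)
    assume "\<not> ?thesis"
    then have "\<not> (\<exists>k. \<not> normal k \<and> k < n + m + 2 \<and> r = 4 * k)"
      by (auto simp: normal_def)
    then obtain k l where "x = 4 * k + 3" "r = 4 * k + 2" "y = 4 * l + 3" "r = 4 * l + 2"
      using leaf_nbr[OF xy(4) P_sym[OF xy(2)]] leaf_nbr[OF xy(5) P_sym[OF xy(3)]] by blast
    then show False using xy(1) by simp
  qed
qed

lemma port_iff:
  assumes "i < n + m + 2" "\<not> normal i"
  shows "P (4 * i) x \<and> \<not> leaf x \<longleftrightarrow> (\<exists>j. normal j \<and> root j = i \<and> x = 4 * j)"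
proof
  assume x: "P (4 * i) x \<and> \<not> leaf x"
  define j where "j = x div 4"
  have x': "x = 4 * j + x mod 4" "x mod 4 < 4" by (auto simp: j_def)
  have "P (4 * i + 0) (4 * j + x mod 4)" using x x'(1) by simp
  then have "normal j \<and> root j = i \<and> x mod 4 = 0 \<or> i = j \<and> 0 < x mod 4"
    using P_iff[of 0 "x mod 4" i j] x'(2) assms(2) by (auto split: if_splits)
  moreover have "\<not> (i = j \<and> 0 < x mod 4)"
  proof
    assume "i = j \<and> 0 < x mod 4"
    then have "leaf (4 * j + x mod 4)" using leaf_root[OF assms, of "x mod 4"] x'(2) by simp
    then show False using x x'(1) by simp
  qed
  ultimately show "\<exists>j. normal j \<and> root j = i \<and> x = 4 * j"
    using x'(1) by auto
next
  assume "\<exists>j. normal j \<and> root j = i \<and> x = 4 * j"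
  then obtain j where "normal j" "root j = i" "x = 4 * j" by blast
  then show "P (4 * i) x \<and> \<not> leaf x"
    using not_leaf_slots(1) assms normal_less(1)[of j] by (simp add: P_slots)
qed

lemma hub_obtain:
  assumes "hub r"
  obtains i where "r = 4 * i" "i < n + m + 2" "\<not> normal i"
  using assms that[of n] that[of "n + 1 + m"] by (auto simp: hub_iff normal_def)

lemma coreI:
  assumes i: "normal i" and s: "0 < s" "s < 4"
  shows "core (4 * i + s)"
  unfolding core_def
proof (intro conjI allI impI notI)
  assume "hub (4 * i + s)"
  then obtain j where j: "4 * i + s = 4 * j" by (rule hub_obtain)
  have "(4 * i + s) mod 4 = s" "(4 * j) mod 4 = 0" using s by auto
  then show False using s j by simp
next
  fix r assume "hub r" "P r (4 * i + s)"
  then obtain j where "r = 4 * j" "\<not> normal j" by (blast elim: hub_obtain)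
  then show False using P_iff[of 0 s j i] i s \<open>P r (4 * i + s)\<close> by simp
qed

text \<open>Numbers beyond the order of the gadget satisfy \<open>core\<close> vacuously; the
  neighbour \<open>y\<close> ensures that \<open>x\<close> is a vertex.\<close>

lemma core_cases:
  assumes "core x" "P x y"
  obtains i where "normal i" "x = 4 * i + 1" | i where "normal i" "x = 4 * i + 2"
    | i where "normal i" "x = 4 * i + 3"
proof -
  define i where "i = x div 4"
  have x': "x = 4 * i + x mod 4" "x mod 4 < 4" by (auto simp: i_def)
  have i: "i < n + m + 2" using assms(2) by (auto simp: P_def gadget_order_def i_def)
  have hub: "hub (4 * j)" if "\<not> normal j" "j < n + m + 2" for j
    using that by (auto simp: hub_iff normal_def)
  have "normal i"
  proof (rule ccontr)
    assume not_normal: "\<not> normal i"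
    show False
    proof (cases "x mod 4 = 0")
      case True
      then show False using assms(1) hub[OF not_normal i] x' by (simp add: core_def)
    next
      case False
      then have "P (4 * i + 0) (4 * i + x mod 4)"
        using P_iff[of 0 "x mod 4" i i] i not_normal x'(2) by simp
      then have "P (4 * i) x" using x'(1) by simp
      then show False using assms(1) hub[OF not_normal i] by (auto simp: core_def)
    qed
  qed
  moreover have "x mod 4 \<noteq> 0"
  proof
    assume "x mod 4 = 0"
    then have x: "x = 4 * i" using x' by simp
    have "hub (4 * root i)" using hub[OF not_normal_root normal_less(2)] .
    moreover have "P (4 * root i) x"
      using \<open>normal i\<close> i normal_less(2) by (simp add: x P_slots not_normal_root)
    ultimately show False using assms(1) by (auto simp: core_def)
  qed
  ultimately have "x = 4 * i + 1 \<or> x = 4 * i + 2 \<or> x = 4 * i + 3"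
    using x' by linarith
  then show thesis using that \<open>normal i\<close> by blast
qed

text \<open>Slots 1, 2, 3 of \<open>i\<close> form a walk towards slot 0 of a linked
  \<open>j\<close>. Conversely, from slot 0 the core is entered at its own slot 1 or at slot 3 of a
  linked index, and from there only the slot 2 of the same index stays in the core. So
  \<open>a\<close> and \<open>c\<close> belong to one index \<open>k\<close>; being different, they
  are its slots 1 and 3, which makes \<open>k\<close> one of \<open>i\<close>, \<open>j\<close> and
  links it to the other.\<close>

lemma joined_iff:
  assumes "normal i" "normal j" "i \<noteq> j"
  shows "joined (4 * i) (4 * j) \<longleftrightarrow> linked G H i j"
proof
  assume "linked G H i j"
  then show "joined (4 * i) (4 * j)"
    unfolding joined_def using assms coreI[OF assms(1), of 1] coreI[OF assms(1), of 2]
      coreI[OF assms(1), of 3] normal_less(1)[of i] normal_less(1)[of j]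
    by (intro exI[of _ "4 * i + 1"] exI[of _ "4 * i + 2"] exI[of _ "4 * i + 3"])
      (simp add: P_slots)
next
  assume "joined (4 * i) (4 * j)"
  then obtain a b c where abc: "a \<noteq> c" "core a" "core b" "core c"
    "P (4 * i) a" "P a b" "P b c" "P c (4 * j)"
    by (auto simp: joined_def)
  have ends: "x = 4 * k + 1 \<or> (\<exists>l. normal l \<and> linked G H k l \<and> x = 4 * l + 3)"
    if "normal k" "core x" "P (4 * k) x" for k x
    by (rule core_cases[OF that(2) P_sym[OF that(3)]]) (use that in \<open>auto simp: P_slots\<close>)
  have middle: "b = 4 * k + 2" if "normal k" "P (4 * k + 1) b \<or> P (4 * k + 3) b" for k
    by (rule core_cases[OF abc(3,7)]) (use that in \<open>auto simp: P_slots\<close>)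
  have a: "a = 4 * i + 1 \<or> (\<exists>l. normal l \<and> linked G H i l \<and> a = 4 * l + 3)"
    using ends assms(1) abc(2,5) by blast
  have c: "c = 4 * j + 1 \<or> (\<exists>l. normal l \<and> linked G H j l \<and> c = 4 * l + 3)"
    using ends assms(2) abc(4) P_sym[OF abc(8)] by blast
  from a obtain k where k: "b = 4 * k + 2" "a = 4 * k + 1 \<and> k = i \<or> a = 4 * k + 3 \<and> linked G H i k"
    using middle abc(6) assms(1) by blast
  from c obtain l where l: "b = 4 * l + 2" "c = 4 * l + 1 \<and> l = j \<or> c = 4 * l + 3 \<and> linked G H j l"
    using middle P_sym[OF abc(7)] assms(2) by blast
  have "k = l" using k(1) l(1) by simp
  then show "linked G H i j"
    using k(2) l(2) abc(1) assms(3) linked_sym by blast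
qed

section \<open>From an involution of the gadget to an isomorphism\<close>

lemma isomorphic_of_involution:
  assumes maps: "\<And>u v. P u v \<Longrightarrow> P (f u) (f v)"
    and inv: "\<And>u. u < gadget_order G H \<Longrightarrow> f (f u) = u"
    and disj: "\<And>u v. P u v \<Longrightarrow> f u \<noteq> u"
  shows "isomorphic G H"
proof -
  have inv': "f (f u) = u" if "P u v" for u v
    using inv that by (auto simp: P_def)
  \<comment> \<open>Preservation in one direction suffices here and below: applied to images, it
    gives the other direction because \<open>f\<close> is its own inverse.\<close>
  have leaf: "leaf (f x)" if x: "leaf x" for x
  proof -
    obtain y where y: "P x y" "\<And>z. P x z \<Longrightarrow> z = y" using x by (auto simp: leaf_def)
    have "z = f y" if "P (f x) z" for z
      using maps[OF that] y(2)[of "f z"] inv'[OF y(1)] inv'[OF P_sym[OF that]] by auto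
    then show ?thesis using maps[OF y(1)] by (auto simp: leaf_def)
  qed
  have leaf_iff: "leaf (f x) \<longleftrightarrow> leaf x" if "P x y" for x y
    using leaf[of x] leaf[of "f x"] inv'[OF that] by auto
  have hub: "hub (f r)" if r: "hub r" for r
  proof -
    obtain x y where xy: "x \<noteq> y" "P r x" "P r y" "leaf x" "leaf y"
      using r by (auto simp: hub_def)
    have "f x \<noteq> f y"
      using xy(1) inv'[OF P_sym[OF xy(2)]] inv'[OF P_sym[OF xy(3)]] by auto
    then show ?thesis
      unfolding hub_def using xy by (intro exI[of _ "f x"] exI[of _ "f y"]) (simp add: maps leaf)
  qed
  have core: "core (f a)" if a: "core a" "P a b" for a b
    unfolding core_def
  proof (intro conjI allI impI notI)
    assume "hub (f a)"
    then show False using hub[of "f a"] inv'[OF a(2)] a(1) by (simp add: core_def)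
  next
    fix r assume "hub r" "P r (f a)"
    then show False using hub[of r] maps[of r "f a"] inv'[OF a(2)] a(1) by (auto simp: core_def)
  qed
  have joined: "joined (f x) (f y)" if xy: "joined x y" for x y
  proof -
    obtain a b c where abc: "a \<noteq> c" "core a" "core b" "core c" "P x a" "P a b" "P b c" "P c y"
      using xy by (auto simp: joined_def)
    have "f a \<noteq> f c" using abc(1) inv'[OF abc(6)] inv'[OF abc(8)] by auto
    then show ?thesis
      unfolding joined_def using abc core[OF abc(2,6)] core[OF abc(3,7)] core[OF abc(4,8)]
      by (intro exI[of _ "f a"] exI[of _ "f b"] exI[of _ "f c"]) (simp add: maps)
  qed
  have order: "4 * n < gadget_order G H" by (simp add: gadget_order_def)
  have hub_n: "hub (4 * n)" by (simp add: hub_iff)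
  then obtain x where "P (4 * n) x" by (auto simp: hub_def)
  then have "f (4 * n) \<noteq> 4 * n" by (rule disj)
  \<comment> \<open>Hubs go to hubs, and this one is not fixed because it has a neighbour.\<close>
  then have f_n: "f (4 * n) = 4 * (n + 1 + m)" using hub[OF hub_n] by (simp add: hub_iff)
  have f_m: "f (4 * (n + 1 + m)) = 4 * n" using f_n inv[OF order] by metis
  have less: "n < n + m + 2" "n + 1 + m < n + m + 2" and root: "\<not> normal n" "\<not> normal (n + 1 + m)"
    by (auto simp: normal_def)
  have port: "\<exists>k. normal k \<and> root k = b \<and> f (4 * j) = 4 * k"
    if j: "normal j" "root j = a" and ab: "f (4 * a) = 4 * b" "a < n + m + 2" "\<not> normal a"
      "b < n + m + 2" "\<not> normal b" for a b j
  proof -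
    have "P (4 * a) (4 * j) \<and> \<not> leaf (4 * j)"
      using port_iff[OF ab(2,3), of "4 * j"] j by blast
    then have "P (f (4 * a)) (f (4 * j)) \<and> \<not> leaf (f (4 * j))"
      using maps leaf_iff P_sym by blast
    then show ?thesis unfolding ab(1) using port_iff[OF ab(4,5)] by blast
  qed
  have to_H: "\<exists>j<m. f (4 * i) = 4 * (n + 1 + j)" if i: "i < n" for i
  proof -
    have "normal i" "root i = n" using i by (auto simp: normal_def root_def)
    from port[OF this f_n less(1) root(1) less(2) root(2)]
    obtain j where j: "normal j" "root j = n + 1 + m" "f (4 * i) = 4 * j" by blast
    then have "n + 1 \<le> j" "j < n + 1 + m" by (auto simp: normal_def root_def split: if_splits)
    then show ?thesis using j(3) by (intro exI[of _ "j - (n + 1)"]) auto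
  qed
  have to_G: "\<exists>j<n. f (4 * (n + 1 + i)) = 4 * j" if i: "i < m" for i
  proof -
    have "normal (n + 1 + i)" "root (n + 1 + i) = n + 1 + m"
      using i by (auto simp: normal_def root_def)
    from port[OF this f_m less(2) root(2) less(1) root(1)]
    obtain j where j: "normal j" "root j = n" "f (4 * (n + 1 + i)) = 4 * j" by blast
    then have "j < n" by (auto simp: normal_def root_def split: if_splits)
    then show ?thesis using j(3) by blast
  qed
  obtain h where h: "\<And>i. i < n \<Longrightarrow> h i < m" "\<And>i. i < n \<Longrightarrow> f (4 * i) = 4 * (n + 1 + h i)"
    using to_H by metis
  obtain g where g: "\<And>i. i < m \<Longrightarrow> g i < n" "\<And>i. i < m \<Longrightarrow> f (4 * (n + 1 + i)) = 4 * g i"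
    using to_G by metis
  \<comment> \<open>\<open>h\<close> and \<open>g\<close> are both read off from \<open>f\<close> on
    slots 0, so their being inverse is just the involution property.\<close>
  have gh: "g (h i) = i" if "i < n" for i
    using h[OF that] g(2)[OF h(1)[OF that]] inv[of "4 * i"] that by (simp add: gadget_order_def)
  have hg: "h (g i) = i" if "i < m" for i
    using g[OF that] h(2)[OF g(1)[OF that]] inv[of "4 * (n + 1 + i)"] that by (simp add: gadget_order_def)
  have bij: "bij_betw h (verts G) (verts H)"
    by (rule bij_betw_byWitness[of _ g]) (use gh hg h(1) g(1) in \<open>auto simp: verts_def\<close>)
  have "{u, v} \<in> edges G \<longleftrightarrow> {h u, h v} \<in> edges H" if uv: "u < n" "v < n" for u v
  \<comment> \<open>An isomorphism must also respect the pairs with \<open>u = v\<close>; there both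
    sides fail, since simple graphs have no loops.\<close>
  proof (cases "u = v")
    case True
    then show ?thesis
      using simple_G simple_H by (auto simp: simple_graph_def doubleton_eq_iff)
  next
    case False
    then have neq: "h u \<noteq> h v" using gh uv by metis
    have nu: "normal u" "normal v" "normal (n + 1 + h u)" "normal (n + 1 + h v)"
      using uv h(1) by (auto simp: normal_def)
    have order_uv: "4 * u < gadget_order G H" "4 * v < gadget_order G H"
      using uv by (auto simp: gadget_order_def)
    have "linked G H u v \<longleftrightarrow> joined (4 * u) (4 * v)"
      using joined_iff[OF nu(1,2) False] by simp
    also have "\<dots> \<longleftrightarrow> joined (f (4 * u)) (f (4 * v))"
      using joined[of "4 * u" "4 * v"] joined[of "f (4 * u)" "f (4 * v)"] inv order_uv by auto
    also have "\<dots> \<longleftrightarrow> linked G H (n + 1 + h u) (n + 1 + h v)"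
      unfolding h(2)[OF uv(1)] h(2)[OF uv(2)] using joined_iff[OF nu(3,4)] neq by simp
    finally show ?thesis using uv h(1) by (simp add: linked_def)
  qed
  then show ?thesis using bij by (auto simp: isomorphic_def graph_isomorphism_def verts_def)
qed

end


section \<open>Simplicity, bipartiteness and the involution given by an isomorphism\<close>

context graph_pair
begin

lemma P_edges: "u < gadget_order G H \<Longrightarrow> v < gadget_order G H \<Longrightarrow> P u v \<longleftrightarrow> {u, v} \<in> edges (gadget G H)"
  by (simp add: P_def edges_gadget)

lemma edge_obtain:
  assumes "e \<in> edges (gadget G H)"
  obtains u v where "e = {u, v}" "P u v"
  using assms by (auto simp: edges_def gadget_def P_def)

lemma P_obtain:
  assumes "P u v"
  obtains i s j t where "u = 4 * i + s" "v = 4 * j + t" "s < 4" "t < 4" "P (4 * i + s) (4 * j + t)"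
    "i < n + m + 2" "j < n + m + 2"
proof (rule that)
  show "u = 4 * (u div 4) + u mod 4" "v = 4 * (v div 4) + v mod 4" "u mod 4 < 4" "v mod 4 < 4"
    by auto
  then show "P (4 * (u div 4) + u mod 4) (4 * (v div 4) + v mod 4)" using assms by simp
  show "u div 4 < n + m + 2" "v div 4 < n + m + 2"
    using assms by (auto simp: P_def gadget_order_def)
qed

lemma verts_gadget: "verts (gadget G H) = {..<gadget_order G H}"
  by (simp add: verts_def gadget_def)

lemma P_irrefl: "\<not> P u u"
proof
  assume "P u u"
  then obtain i s where "s < 4" "P (4 * i + s) (4 * i + s)"
    by (metis mod_less_divisor mult_div_mod_eq zero_less_numeral)
  then show False using P_iff[of s s i i] linked_irrefl by (auto split: if_splits)
qed

lemma simple_gadget: "simple_graph (gadget G H)"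
  unfolding simple_graph_def
proof
  fix e assume "e \<in> edges (gadget G H)"
  then obtain u v where e: "e = {u, v}" "P u v" by (rule edge_obtain)
  moreover have "u \<noteq> v" using e(2) P_irrefl by blast
  moreover have "u < gadget_order G H" "v < gadget_order G H" using e(2) by (auto simp: P_def)
  ultimately show "e \<in> {{u, v} |u v. u \<in> verts (gadget G H) \<and> v \<in> verts (gadget G H) \<and> u \<noteq> v}"
    unfolding verts_gadget by blast
qed

lemma bipartite_gadget: "bipartite (gadget G H)"
proof -
  \<comment> \<open>Paths alternate by parity of the slot. A hub is opposite to all slots 0 of its
    half, hence its leaves take the colour of those slots.\<close>
  define C where "C u \<longleftrightarrow> (if normal (u div 4) then u mod 4 = 0 \<or> u mod 4 = 2 else u mod 4 \<noteq> 0)" for u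
  have C: "C u \<noteq> C v" if "P u v" for u v
    using that
  proof (rule P_obtain)
    fix i s j t
    assume *: "u = 4 * i + s" "v = 4 * j + t" "s < 4" "t < 4" "P (4 * i + s) (4 * j + t)"
    have "C u \<longleftrightarrow> (if normal i then s = 0 \<or> s = 2 else s \<noteq> 0)"
      "C v \<longleftrightarrow> (if normal j then t = 0 \<or> t = 2 else t \<noteq> 0)"
      using *(1-4) by (simp_all add: C_def)
    moreover have "s = 0 \<or> s = 1 \<or> s = 2 \<or> s = 3" using *(3) by linarith
    ultimately show ?thesis
      using P_iff[OF *(3,4), of i j] *(4,5) by (elim disjE) (auto split: if_splits)
  qed
  show ?thesis
    unfolding bipartite_def
  proof (intro exI conjI ballI)
    let ?X = "{u \<in> verts (gadget G H). C u}" and ?Y = "{u \<in> verts (gadget G H). \<not> C u}"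
    show "?X \<union> ?Y = verts (gadget G H)" "?X \<inter> ?Y = {}" by auto
    fix e assume "e \<in> edges (gadget G H)"
    then obtain u v where e: "e = {u, v}" "P u v" by (rule edge_obtain)
    have uv: "u \<in> verts (gadget G H)" "v \<in> verts (gadget G H)"
      using e(2) by (auto simp: P_def verts_gadget)
    show "\<exists>x \<in> ?X. \<exists>y \<in> ?Y. e = {x, y}"
    proof (cases "C u")
      case True
      then show ?thesis using C[OF e(2)] uv e(1) by blast
    next
      case False
      then show ?thesis using C[OF e(2)] uv e(1) by blast
    qed
  qed
qed

lemma involution_of_isomorphism:
  assumes "isomorphic G H"
  shows "\<exists>f. involutive_automorphism f (gadget G H) \<and> (\<forall>e \<in> edges (gadget G H). e \<inter> f ` e = {})"
proof -
  obtain h where h: "graph_isomorphism h G H" using assms by (auto simp: isomorphic_def)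
  define g where "g = inv_into (verts G) h"
  have bij: "bij_betw h {..<n} {..<m}" using h by (simp add: graph_isomorphism_def verts_def)
  have edge: "{h i, h j} \<in> edges H \<longleftrightarrow> {i, j} \<in> edges G" if "i < n" "j < n" for i j
    using h that by (simp add: graph_isomorphism_def verts_def)
  have hm: "h i < m" if "i < n" for i
    using bij_betwE[OF bij] that by auto
  have gn: "g i < n" if "i < m" for i
    using bij_betwE[OF bij_betw_inv_into[OF bij]] that by (auto simp: g_def verts_def)
  have gh: "g (h i) = i" if "i < n" for i
    using bij_betw_inv_into_left[OF bij] that by (simp add: g_def verts_def)
  have hg: "h (g i) = i" if "i < m" for i
    using bij_betw_inv_into_right[OF bij] that by (simp add: g_def verts_def)
  have edge': "{g i, g j} \<in> edges G \<longleftrightarrow> {i, j} \<in> edges H" if "i < m" "j < m" for i j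
    using edge[OF gn gn] that hg by simp
  \<comment> \<open>The involution permutes objects and keeps slots, so it is described by its
    action on indices.\<close>
  define swap where "swap i = (if i < n then n + 1 + h i else if i = n then n + 1 + m
      else if i < n + 1 + m then g (i - (n + 1)) else n)" for i
  have swap_G: "swap i = n + 1 + h i" if "i < n" for i using that by (simp add: swap_def)
  have swap_H: "swap (n + 1 + i) = g i" if "i < m" for i using that by (simp add: swap_def)
  have swap_root: "swap n = n + 1 + m" "swap (n + 1 + m) = n" by (auto simp: swap_def)
  have cases: "(i < n) \<or> i = n \<or> (\<exists>k<m. i = n + 1 + k) \<or> i = n + 1 + m" if "i < n + m + 2" for i
  proof -
    have "i < n \<or> i = n \<or> (i = n + 1 + (i - (n + 1)) \<and> i - (n + 1) < m) \<or> i = n + 1 + m"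
      using that by linarith
    then show ?thesis by blast
  qed
  have swap_props: "swap i < n + m + 2 \<and> swap (swap i) = i \<and> (normal (swap i) \<longleftrightarrow> normal i) \<and>
      root (swap i) = swap (root i) \<and> root (swap i) \<noteq> root i" if "i < n + m + 2" for i
    using cases[OF that]
  proof (elim disjE exE conjE)
    assume i: "i < n"
    then show ?thesis
      using hm[OF i] swap_H[OF hm[OF i]] gh[OF i]
      by (simp add: swap_G normal_def root_def swap_root)
  next
    assume "i = n"
    then show ?thesis using swap_root by (simp add: normal_def root_def)
  next
    fix k assume k: "k < m" "i = n + 1 + k"
    then show ?thesis
      using gn[OF k(1)] swap_G[OF gn[OF k(1)]] hg[OF k(1)] swap_H[OF k(1)] swap_root
      by (simp add: normal_def root_def)
  next
    assume "i = n + 1 + m"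
    then show ?thesis using swap_root by (simp add: normal_def root_def)
  qed
  have linked_swap: "linked G H (swap i) (swap j)" if ij: "linked G H i j" for i j
  proof -
    consider "i < n" "j < n" "{i, j} \<in> edges G"
      | k l where "i = n + 1 + k" "j = n + 1 + l" "k < m" "l < m" "{k, l} \<in> edges H"
    proof -
      assume a: "i < n \<Longrightarrow> j < n \<Longrightarrow> {i, j} \<in> edges G \<Longrightarrow> thesis"
        and b: "\<And>k l. i = n + 1 + k \<Longrightarrow> j = n + 1 + l \<Longrightarrow> k < m \<Longrightarrow> l < m \<Longrightarrow> {k, l} \<in> edges H \<Longrightarrow> thesis"
      show thesis
        using ij a b[of "i - (n + 1)" "j - (n + 1)"] by (auto simp: linked_def)
    qed
    then show ?thesis
    proof cases
      case 1
      then show ?thesis using edge hm by (simp add: swap_G linked_def)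
    next
      case (2 k l)
      then show ?thesis using edge' gn swap_H[of k] swap_H[of l] by (simp add: linked_def)
    qed
  qed
  have swap_eq: "swap i = swap j \<longleftrightarrow> i = j" if "i < n + m + 2" "j < n + m + 2" for i j
    using swap_props that by metis
  have linked_swap_iff: "linked G H (swap i) (swap j) \<longleftrightarrow> linked G H i j"
    if "i < n + m + 2" "j < n + m + 2" for i j
    using linked_swap[of i j] linked_swap[of "swap i" "swap j"] swap_props that by auto
  have P_swap: "P (4 * swap i + s) (4 * swap j + t) \<longleftrightarrow> P (4 * i + s) (4 * j + t)"
    if "i < n + m + 2" "j < n + m + 2" "s < 4" "t < 4" for i j s t
  proof -
    \<comment> \<open>As \<open>swap\<close> commutes with \<open>root\<close>, the clauses of
      \<open>P_iff\<close> about hubs are invariant too.\<close>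
    have "swap j = root (swap i) \<longleftrightarrow> j = root i" "swap i = root (swap j) \<longleftrightarrow> i = root j"
      using swap_eq that normal_less(2) swap_props by metis+
    then show ?thesis
      using that swap_props[OF that(1)] swap_props[OF that(2)]
      by (simp add: P_iff swap_eq linked_swap_iff)
  qed
  define f where "f u = 4 * swap (u div 4) + u mod 4" for u
  have order: "u < gadget_order G H \<longleftrightarrow> u div 4 < n + m + 2" for u
    by (auto simp: gadget_order_def)
  have f_less: "f u < gadget_order G H" if "u < gadget_order G H" for u
    using swap_props[of "u div 4"] that unfolding order by (simp add: f_def)
  have f_f: "f (f u) = u" if "u < gadget_order G H" for u
    using swap_props[of "u div 4"] that unfolding order by (simp add: f_def)
  have P_f: "P (f u) (f v) \<longleftrightarrow> P u v" if "u < gadget_order G H" "v < gadget_order G H" for u v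
    unfolding f_def using P_swap[of "u div 4" "v div 4" "u mod 4" "v mod 4"] that order by simp
  have moved: "f u \<noteq> u \<and> f u \<noteq> v" if "P u v" for u v
    using that
  proof (rule P_obtain)
    fix i s j t
    assume *: "u = 4 * i + s" "v = 4 * j + t" "s < 4" "t < 4" "P (4 * i + s) (4 * j + t)"
      "i < n + m + 2" "j < n + m + 2"
    have "root (root i) = root i" for i by (simp add: root_def)
    moreover have "i = n \<or> i = n + 1 + m" if "\<not> normal i" "i < n + m + 2" for i
      using that by (auto simp: normal_def)
    \<comment> \<open>No edge leaves its half, while \<open>swap\<close> changes the half; so the
      image of \<open>u\<close> is neither endpoint.\<close>
    ultimately have "root i = root j"
      using P_iff[OF *(3,4), of i j] *(5) linked_normal by (auto split: if_splits)
    then have "swap i \<noteq> i" "swap i \<noteq> j" using swap_props[OF *(6)] by auto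
    moreover have "f u div 4 = swap i" "u div 4 = i" "v div 4 = j"
      using * by (simp_all add: f_def)
    ultimately show ?thesis by metis
  qed
  have "bij_betw f {..<gadget_order G H} {..<gadget_order G H}"
    by (rule bij_betw_byWitness[of _ f]) (auto simp: f_f f_less)
  moreover have "{u, v} \<in> edges (gadget G H) \<longleftrightarrow> {f u, f v} \<in> edges (gadget G H)"
    if "u < gadget_order G H" "v < gadget_order G H" for u v
    using P_f[OF that] P_edges[OF that] P_edges[OF f_less f_less] that by simp
  ultimately have "involutive_automorphism f (gadget G H)"
    by (simp add: involutive_automorphism_def automorphism_def graph_isomorphism_def verts_gadget f_f)
  moreover have "e \<inter> f ` e = {}" if "e \<in> edges (gadget G H)" for e
    using that
  proof (rule edge_obtain)
    fix u v assume "e = {u, v}" "P u v"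
    then show ?thesis using moved[of u v] moved[of v u] P_sym by auto
  qed
  ultimately show ?thesis by blast
qed

lemma gadget_involution_iff:
  "(\<exists>f. involutive_automorphism f (gadget G H) \<and> (\<forall>e \<in> edges (gadget G H). e \<inter> f ` e = {})) \<longleftrightarrow>
    isomorphic G H"
proof
  assume "\<exists>f. involutive_automorphism f (gadget G H) \<and> (\<forall>e \<in> edges (gadget G H). e \<inter> f ` e = {})"
  then obtain f where f: "involutive_automorphism f (gadget G H)"
    "\<And>e. e \<in> edges (gadget G H) \<Longrightarrow> e \<inter> f ` e = {}" by blast
  have less: "f u < gadget_order G H" if "u < gadget_order G H" for u
    using f(1) that bij_betwE
    by (fastforce simp: involutive_automorphism_def automorphism_def graph_isomorphism_def verts_gadget)
  show "isomorphic G H"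
  proof (rule isomorphic_of_involution)
    show "P (f u) (f v)" if "P u v" for u v
    proof -
      have uv: "u < gadget_order G H" "v < gadget_order G H" using that by (auto simp: P_def)
      then have "{u, v} \<in> edges (gadget G H) \<longleftrightarrow> {f u, f v} \<in> edges (gadget G H)"
        using f(1) by (simp add: involutive_automorphism_def automorphism_def graph_isomorphism_def verts_gadget)
      then show ?thesis using P_edges[OF uv] P_edges[OF less less, OF uv] that by simp
    qed
    show "f (f u) = u" if "u < gadget_order G H" for u
      using f(1) that by (simp add: involutive_automorphism_def verts_gadget)
    show "f u \<noteq> u" if "P u v" for u v
    proof -
      have "u < gadget_order G H" "v < gadget_order G H" using that by (auto simp: P_def)
      then have "{u, v} \<in> edges (gadget G H)" using P_edges that by blast
      \<comment> \<open>A fixed \<open>u\<close> would lie both in the edge and in its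
        image.\<close>
      then show ?thesis using f(2)[of "{u, v}"] by auto
    qed
  qed
qed (rule involution_of_isomorphism)

end


section \<open>Correctness of the program\<close>

definition matrix_bits :: "graph \<Rightarrow> bool list" where
  "matrix_bits G = concat (map (\<lambda>u. map (\<lambda>v. {u, v} \<in> edges G) [0..<fst G]) [0..<fst G])"

lemma length_concat_rows: "length (concat (map (\<lambda>u. map (F u) [0..<b]) [0..<a])) = a * b"
  by (induction a) auto

lemma nth_concat_rows:
  assumes "u < a" "v < b"
  shows "concat (map (\<lambda>u. map (F u) [0..<b]) [0..<a]) ! (u * b + v) = F u v"
  using assms(1)
proof (induction a)
  case (Suc a)
  show ?case
  proof (cases "u < a")
    case True
    then have "Suc u * b \<le> a * b" by (intro mult_le_mono) auto
    then have "u * b + v < a * b" using assms(2) by simp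
    then show ?thesis using Suc True by (simp add: nth_append length_concat_rows)
  next
    case False
    then have "u = a" using Suc.prems by simp
    then show ?thesis using assms(2) by (simp add: nth_append length_concat_rows)
  qed
qed simp

lemma length_matrix_bits: "length (matrix_bits G) = fst G * fst G"
  by (simp add: matrix_bits_def length_concat_rows)

lemma nth_matrix_bits:
  "u < fst G \<Longrightarrow> v < fst G \<Longrightarrow> matrix_bits G ! (u * fst G + v) \<longleftrightarrow> {u, v} \<in> edges G"
  unfolding matrix_bits_def by (rule nth_concat_rows)

text \<open>Serves twice in \<open>encode_gadget\<close>: for the columns within a row and for the
  sequence of rows.\<close>

lemma concat_map_blocks:
  "map F [0..<4 * k] = concat (map (\<lambda>i. map (\<lambda>s. F (4 * i + s)) [0..<4]) [0..<k])"
proof (induction k)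
  case (Suc k)
  have "[0..<4 * Suc k] = [0..<4 * k] @ [4 * k, 4 * k + 1, 4 * k + 2, 4 * k + 3]"
    by (simp add: upt_conv_Cons numeral_eq_Suc)
  then show ?case using Suc by (simp add: numeral_eq_Suc)
qed simp

section \<open>Where the adjacency bits of the two graphs lie on tape 5\<close>

definition index_list :: "nat \<Rightarrow> nat \<Rightarrow> nat list" where
  "index_list n m = replicate n 1 @ [2] @ replicate m 3 @ [4]"

lemma length_index_list: "length (index_list n m) = n + m + 2"
  by (simp add: index_list_def)

lemma nth_index_list: "i < n + m + 2 \<Longrightarrow> index_list n m ! i = kind n m i"
  by (auto simp: index_list_def kind_def nth_append nth_Cons')

text \<open>The number of input bits passed before row \<open>i\<close>, column \<open>j\<close>.
  \<open>min\<close> and truncated subtraction freeze it while the column is outside the half of the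
  row.\<close>

definition matrix_pos :: "nat \<Rightarrow> nat \<Rightarrow> nat \<Rightarrow> nat \<Rightarrow> nat" where
  "matrix_pos n m i j =
     (if i < n then i * n + min j n
      else if i = n then n * n
      else if i < n + 1 + m then n * n + (i - (n + 1)) * m + (min j (n + 1 + m) - (n + 1))
      else n * n + m * m)"

lemma same_kind:
  "same (kind n m i) (kind n m j) \<longleftrightarrow>
     (i < n \<and> j < n) \<or> (n < i \<and> i < n + 1 + m \<and> n < j \<and> j < n + 1 + m)"
  by (auto simp: kind_def same_def)

context graph_pair
begin

abbreviation "ix \<equiv> index_list n m"

definition mat :: "nat list" where
  "mat = map bit_symbol (matrix_bits G @ matrix_bits H)"

lemma mat_pos:
  assumes "same (kind n m i) (kind n m j)"
  shows "matrix_pos n m i j < length mat \<and> (mat ! matrix_pos n m i j = 2 \<longleftrightarrow> linked G H i j)"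
proof -
  have bit: "bit_symbol b = 2 \<longleftrightarrow> b" for b by (simp add: bit_symbol_def)
  consider "i < n" "j < n" | k l where "i = n + 1 + k" "j = n + 1 + l" "k < m" "l < m"
  proof -
    assume a: "i < n \<Longrightarrow> j < n \<Longrightarrow> thesis"
      and b: "\<And>k l. i = n + 1 + k \<Longrightarrow> j = n + 1 + l \<Longrightarrow> k < m \<Longrightarrow> l < m \<Longrightarrow> thesis"
    show thesis
      using assms a b[of "i - (n + 1)" "j - (n + 1)"] by (auto simp: same_kind)
  qed
  then show ?thesis
  proof cases
    case 1
    have "Suc i * n \<le> n * n" using 1 by (intro mult_le_mono) auto
    then have less: "i * n + j < n * n" using 1 by simp
    have "matrix_pos n m i j = i * n + j" using 1 by (simp add: matrix_pos_def)
    then show ?thesis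
      using less 1 nth_matrix_bits[of i G j]
      by (simp add: mat_def length_matrix_bits nth_append bit linked_def)
  next
    case (2 k l)
    have "Suc k * m \<le> m * m" using 2 by (intro mult_le_mono) auto
    then have less: "k * m + l < m * m" using 2 by simp
    have "matrix_pos n m i j = n * n + (k * m + l)" using 2 by (simp add: matrix_pos_def)
    then show ?thesis
      using less 2 nth_matrix_bits[of k H l]
      by (simp add: mat_def length_matrix_bits nth_append bit linked_def)
  qed
qed

sublocale writer: matrix_writer ix mat "matrix_pos n m"
proof
  show "0 \<notin> set ix" by (auto simp: index_list_def)
next
  fix i j assume "i < length ix" "j < length ix"
  then have ij: "i < n + m + 2" "j < n + m + 2" by (simp_all add: length_index_list)
  show "matrix_pos n m i (Suc j) = matrix_pos n m i j + (if same (ix ! i) (ix ! j) then 1 else 0)"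
    unfolding nth_index_list[OF ij(1)] nth_index_list[OF ij(2)] same_kind matrix_pos_def
    using ij by auto
  show "matrix_pos n m i j < length mat" if "same (ix ! i) (ix ! j)"
    using mat_pos that unfolding nth_index_list[OF ij(1)] nth_index_list[OF ij(2)] by blast
next
  fix i assume i: "i < length ix"
  \<comment> \<open>The last row of either matrix ends at \<open>a * b + b\<close>, which has to be
    recognised as the full square.\<close>
  have square_Suc: "b * b = a * b + b" if "Suc a = b" for a b :: nat
    using that by auto
  consider "Suc i < n" | "Suc i = n" | "i = n" | k where "i = n + 1 + k" "Suc k < m"
    | k where "i = n + 1 + k" "Suc k = m" | "i = n + 1 + m"
  proof -
    assume *: "Suc i < n \<Longrightarrow> thesis" "Suc i = n \<Longrightarrow> thesis" "i = n \<Longrightarrow> thesis"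
      "\<And>k. i = n + 1 + k \<Longrightarrow> Suc k < m \<Longrightarrow> thesis"
      "\<And>k. i = n + 1 + k \<Longrightarrow> Suc k = m \<Longrightarrow> thesis" "i = n + 1 + m \<Longrightarrow> thesis"
    have "Suc i < n \<or> Suc i = n \<or> i = n \<or> (i = n + 1 + (i - (n + 1)) \<and> Suc (i - (n + 1)) < m)
        \<or> (i = n + 1 + (i - (n + 1)) \<and> Suc (i - (n + 1)) = m) \<or> i = n + 1 + m"
      using i unfolding length_index_list by linarith
    then show thesis using * by blast
  qed
  then show "matrix_pos n m (Suc i) 0 = matrix_pos n m i (length ix)"
    by cases (auto simp: matrix_pos_def length_index_list square_Suc)
qed

text \<open>Linked indices always have equal odd kinds, so ignoring tape 5 outside the pairs with
  \<open>same\<close> loses no edge.\<close>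

lemma entry_gadget:
  assumes "i < n + m + 2" "j < n + m + 2" "s < 4" "t < 4"
  shows "writer.entry i s j t \<longleftrightarrow> {4 * i + s, 4 * j + t} \<in> edges (gadget G H)"
proof -
  have "same (kind n m i) (kind n m j)" if "linked G H i j"
    using that by (auto simp: linked_def same_kind)
  then have "(same (kind n m i) (kind n m j) \<and> mat ! matrix_pos n m i j = 2) \<longleftrightarrow> linked G H i j"
    using mat_pos by blast
  moreover have "4 * i + s < gadget_order G H" "4 * j + t < gadget_order G H"
    using assms by (auto simp: gadget_order_def)
  ultimately show ?thesis
    unfolding writer.entry_def nth_index_list[OF assms(1)] nth_index_list[OF assms(2)]
    using assms(3,4) by (simp add: edges_gadget gadget_adj_def)
qed

lemma encode_gadget:
  "map bit_symbol (encode_graph (gadget G H)) =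
     replicate (gadget_order G H) 2 @ [1] @ concat (map writer.rows [0..<n + m + 2])"
proof -
  let ?E = "\<lambda>u v. {u, v} \<in> edges (gadget G H)"
  have block: "writer.block i s j = map bit_symbol (map (\<lambda>t. ?E (4 * i + s) (4 * j + t)) [0..<4])"
    if "i < n + m + 2" "j < n + m + 2" "s < 4" for i j s
    using entry_gadget[OF that] by (simp add: writer.block_def)
  have rows: "writer.rows i = map bit_symbol (concat (map (\<lambda>s. map (?E (4 * i + s)) [0..<gadget_order G H]) [0..<4]))"
    if i: "i < n + m + 2" for i
  proof -
    have "concat (map (writer.block i s) [0..<n + m + 2]) =
        map bit_symbol (map (?E (4 * i + s)) [0..<gadget_order G H])" if s: "s < 4" for s
    proof -
      have "map (writer.block i s) [0..<n + m + 2] =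
          map (\<lambda>j. map bit_symbol (map (\<lambda>t. ?E (4 * i + s) (4 * j + t)) [0..<4])) [0..<n + m + 2]"
        by (intro map_cong refl block i s) (simp only: set_upt atLeastLessThan_iff)
      then show ?thesis
        unfolding gadget_order_def concat_map_blocks by (simp only: map_concat map_map comp_def)
    qed
    then show ?thesis
      unfolding writer.rows_def length_index_list map_concat map_map comp_def
      by (intro arg_cong[of _ _ concat] map_cong refl) simp
  qed
  have matrix: "concat (map (\<lambda>u. map (?E u) [0..<gadget_order G H]) [0..<gadget_order G H]) =
      concat (map (\<lambda>i. concat (map (\<lambda>s. map (?E (4 * i + s)) [0..<gadget_order G H]) [0..<4])) [0..<n + m + 2])"
  proof -
    have "map (\<lambda>u. map (?E u) [0..<gadget_order G H]) [0..<4 * (n + m + 2)] =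
      concat (map (\<lambda>i. map (\<lambda>s. map (?E (4 * i + s)) [0..<gadget_order G H]) [0..<4]) [0..<n + m + 2])"
      by (rule concat_map_blocks)
    moreover have "concat (concat xss) = concat (map concat xss)" for xss :: "bool list list list"
      by (induction xss) auto
    ultimately show ?thesis
      unfolding gadget_order_def[symmetric] by (simp only: map_map comp_def)
  qed
  have "map bit_symbol (concat (map (\<lambda>u. map (?E u) [0..<gadget_order G H]) [0..<gadget_order G H])) =
      concat (map writer.rows [0..<n + m + 2])"
    unfolding matrix map_concat map_map comp_def
    by (intro arg_cong[of _ _ concat] map_cong refl)
      (simp only: set_upt atLeastLessThan_iff rows map_concat map_map comp_def)
  moreover have "fst (gadget G H) = gadget_order G H" by (simp add: gadget_def)
  ultimately show ?thesis
    by (simp only: encode_graph_def map_append map_replicate bit_symbol_def if_True if_False list.map)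
qed

lemma encode_pair:
  "map bit_symbol (encode_graph G @ encode_graph H) =
     replicate n 2 @ 1 # map bit_symbol (matrix_bits G) @ replicate m 2 @ 1 # map bit_symbol (matrix_bits H)"
  by (simp add: encode_graph_def matrix_bits_def bit_symbol_def[of True] bit_symbol_def[of False])

text \<open>The constant costs of the phases add up to 53, and 55 is the quadratic coefficient of
  \<open>reach_write_matrix\<close>; the linear coefficient 83 is generous. Both the list of objects
  and \<open>mat\<close> are no longer than the input, as the encoding contains the orders in
  unary.\<close>

lemma reach_reduction:
  defines "inp \<equiv> map bit_symbol (encode_graph G @ encode_graph H)"
  shows "\<exists>tps. reach reduction_com
      [ltape inp 0, etape [], etape [], etape [], etape [], etape []]
      (53 + 83 * length inp + 55 * (length inp * length inp)) tps \<and>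
    length tps = 6 \<and> tps ! 1 = etape (map bit_symbol (encode_graph (gadget G H)))"
proof -
  let ?bG = "map bit_symbol (matrix_bits G)" and ?bH = "map bit_symbol (matrix_bits H)"
  have inp: "inp = [] @ replicate n 2 @ 1 # ?bG @ (replicate m 2 @ 1 # ?bH)"
    "inp = ([] @ replicate n 2 @ 1 # ?bG) @ replicate m 2 @ 1 # ?bH @ []"
    unfolding inp_def encode_pair by simp_all
  have ix: "([] @ replicate n 1 @ [Suc 1]) @ replicate m 3 @ [Suc 3] = ix"
    by (simp add: index_list_def)
  have mat: "([] @ ?bG) @ ?bH = mat" by (simp add: mat_def)
  have out: "([] @ replicate (4 * Suc n) 2) @ replicate (4 * Suc m) (2::nat) = replicate (gadget_order G H) 2"
    by (simp add: gadget_order_def replicate_add[symmetric] algebra_simps del: replicate_Suc)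
  have len: "length ?bG = n * n" "length ?bH = m * m" by (simp_all add: length_matrix_bits)
  have 1: "reach (read_graph 1) [ltape inp 0, etape [], etape [], etape [], etape [], etape []]
      (6 * n * n + 16 * n + 20)
      [ltape inp (int (length ([] @ replicate n 2 @ 1 # ?bG))), etape ([] @ replicate (4 * Suc n) 2),
       etape ([] @ replicate n 1 @ [Suc 1]), etape ([] @ replicate n 1 @ [Suc 1]), etape [], etape ([] @ ?bG)]"
    using reach_read_graph[OF inp(1) len(1), of 1 "[]" "[]" "etape []" "[]"] by simp
  let ?p = "int (length (([] @ replicate n 2 @ 1 # ?bG) @ replicate m 2 @ 1 # ?bH))"
  have 2: "reach (read_graph 3)
      [ltape inp (int (length ([] @ replicate n 2 @ 1 # ?bG))), etape ([] @ replicate (4 * Suc n) 2),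
       etape ([] @ replicate n 1 @ [Suc 1]), etape ([] @ replicate n 1 @ [Suc 1]), etape [], etape ([] @ ?bG)]
      (6 * m * m + 16 * m + 20)
      [ltape inp ?p, etape (replicate (gadget_order G H) 2), etape ix, etape ix, etape [], etape mat]"
    using reach_read_graph[OF inp(2) len(2), of 3 "[] @ replicate n 1 @ [Suc 1]"
        "[] @ replicate (4 * Suc n) 2" "etape []" "[] @ ?bG"]
    unfolding ix mat out by simp
  let ?out = "replicate (gadget_order G H) 2 @ [1]"
  have 3: "reach (put 1 (\<lambda>_. 1) ;; put 4 (\<lambda>_. 1) ;; left 4)
      [ltape inp ?p, etape (replicate (gadget_order G H) 2), etape ix, etape ix, etape [], etape mat] 3
      [ltape inp ?p, etape ?out, etape ix, etape ix, ltape [1] 0, etape mat]"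
    by (rule reach_straight) simp_all
  have ix0: "0 \<notin> set ix" by (rule writer.nonzero)
  have mat0: "0 \<notin> set mat" by (auto simp: mat_def bit_symbol_def)
  have 4: "reach (rewind 2) [ltape inp ?p, etape ?out, etape ix, etape ix, ltape [1] 0, etape mat]
      (2 * length ix + 3) [ltape inp ?p, etape ?out, ltape ix 0, etape ix, ltape [1] 0, etape mat]"
    using reach_rewind[OF _ _ ix0, of 2 "[ltape inp ?p, etape ?out, etape ix, etape ix, ltape [1] 0, etape mat]"]
    by simp
  have 5: "reach (rewind 3) [ltape inp ?p, etape ?out, ltape ix 0, etape ix, ltape [1] 0, etape mat]
      (2 * length ix + 3) [ltape inp ?p, etape ?out, ltape ix 0, ltape ix 0, ltape [1] 0, etape mat]"
    using reach_rewind[OF _ _ ix0, of 3 "[ltape inp ?p, etape ?out, ltape ix 0, etape ix, ltape [1] 0, etape mat]"]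
    by simp
  have 6: "reach (rewind 5) [ltape inp ?p, etape ?out, ltape ix 0, ltape ix 0, ltape [1] 0, etape mat]
      (2 * length mat + 3) [ltape inp ?p, etape ?out, ltape ix 0, ltape ix 0, ltape [1] 0, ltape mat 0]"
    using reach_rewind[OF _ _ mat0, of 5 "[ltape inp ?p, etape ?out, ltape ix 0, ltape ix 0, ltape [1] 0, etape mat]"]
    by simp
  have start: "[ltape inp ?p, etape ?out, ltape ix 0, ltape ix 0, ltape [1] 0, ltape mat 0] =
      writer.state (ltape inp ?p) ?out 0 0 (matrix_pos n m 0 0)"
    by (auto simp: writer.state_def matrix_pos_def)
  note 7 = writer.reach_write_matrix[of "ltape inp ?p" ?out, folded start]
  let ?end = "writer.state (ltape inp ?p) (?out @ concat (map writer.rows [0..<length ix])) (length ix) 0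
      (matrix_pos n m (length ix) 0)"
  let ?N = "length inp"
  have N: "?N = n + m + 2 + n * n + m * m"
    by (simp add: inp(1) length_matrix_bits)
  have ix_N: "length ix \<le> ?N" by (simp add: N length_index_list)
  then have ix_sq: "length ix * length ix \<le> ?N * ?N" by (intro mult_le_mono)
  have mat_N: "length mat = n * n + m * m" by (simp add: mat_def length_matrix_bits)
  have "reach reduction_com [ltape inp 0, etape [], etape [], etape [], etape [], etape []]
      (53 + 83 * ?N + 55 * (?N * ?N)) ?end"
    unfolding reduction_com_def
    by (rule reach_mono[OF reach_Seq[OF 1 reach_Seq[OF 2 reach_Seq[OF 3 reach_Seq[OF 4 reach_Seq[OF 5
        reach_Seq[OF 6 7]]]]]]])
      (use ix_N ix_sq mat_N N in \<open>simp add: algebra_simps\<close>)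
  moreover have "?end ! 1 = etape (map bit_symbol (encode_graph (gadget G H)))"
    unfolding encode_gadget by (simp add: writer.state_def length_index_list)
  moreover have "length ?end = 6" by (simp add: writer.state_def)
  ultimately show ?thesis by blast
qed

end

section \<open>Polynomial-time computability and hardness\<close>

lemma tape_holds_etape: "tape_holds (etape (map bit_symbol y)) y"
  by (simp add: tape_holds_def etape_def ltape_def)

lemma input_tape_ltape: "input_tape x = ltape (map bit_symbol x) 0"
  by (auto simp: input_tape_def ltape_def fun_eq_iff)

lemma blank_tape_etape: "blank_tape = etape []"
  by (auto simp: blank_tape_def etape_def ltape_def fun_eq_iff)

lemma reduction_computes:
  assumes "simple_graph G" "simple_graph H"
  shows "computes_within (compile 6 5 reduction_com) (encode_graph G @ encode_graph H)
    (encode_graph (gadget G H))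
    (poly [:53, 83, 55:] (length (encode_graph G @ encode_graph H)))"
proof -
  let ?x = "encode_graph G @ encode_graph H"
  interpret graph_pair G H by unfold_locales (use assms in auto)
  have init: "init_config (compile 6 5 reduction_com) ?x =
      (0, [ltape (map bit_symbol ?x) 0, etape [], etape [], etape [], etape [], etape []])"
    by (simp add: init_config_def compile_def input_tape_ltape blank_tape_etape numeral_eq_Suc)
  have time: "53 + 83 * length (map bit_symbol ?x) + 55 * (length (map bit_symbol ?x) * length (map bit_symbol ?x)) =
      poly [:53, 83, 55:] (length ?x)"
    by (simp add: algebra_simps)
  obtain tps where tps: "reach reduction_com
      [ltape (map bit_symbol ?x) 0, etape [], etape [], etape [], etape [], etape []]
      (poly [:53, 83, 55:] (length ?x)) tps" "tps ! 1 = etape (map bit_symbol (encode_graph (gadget G H)))"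
    using reach_reduction unfolding time by blast
  show ?thesis
    unfolding computes_within_def init reach_tm_step[OF tps(1)]
    using tps(2) tape_holds_etape by (simp add: compile_def)
qed

lemma reduction_poly_time:
  "poly_time_computable {(G, H). simple_graph G \<and> simple_graph H}
     (\<lambda>(G, H). encode_graph G @ encode_graph H) encode_graph (\<lambda>(G, H). gadget G H)"
  unfolding poly_time_computable_def
  using wf_compile[OF wf_reduction_com] reduction_computes
  by (intro exI[of _ "compile 6 5 reduction_com"] exI[of _ "[:53, 83, 55:]"]) auto

theorem theorem6:
  "GI_hard edge_disjoint_involution_problem \<and>
   GI_hard (restrict_problem edge_disjoint_involution_problem bipartite)"
proof -
  have correct: "simple_graph (gadget G H) \<and> bipartite (gadget G H) \<and>
      ((\<exists>f. involutive_automorphism f (gadget G H) \<and> (\<forall>e \<in> edges (gadget G H). e \<inter> f ` e = {})) \<longleftrightarrow>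
        isomorphic G H)"
    if "simple_graph G" "simple_graph H" for G H
  proof -
    interpret graph_pair G H by unfold_locales (use that in auto)
    show ?thesis using simple_gadget bipartite_gadget gadget_involution_iff by blast
  qed
  \<comment> \<open>The gadget is bipartite for all inputs, so one map reduces to both the
    unrestricted and the restricted problem.\<close>
  show ?thesis
    unfolding GI_hard_def poly_time_reduces_def restrict_problem_def GI_problem_def
      edge_disjoint_involution_problem_def
    using reduction_poly_time correct
    by (intro conjI exI[of _ "\<lambda>(G, H). gadget G H"]) auto
qed

end
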